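(* Let $d\geq 2$, let $L$ be a positive even integer, and consider the torus $\mathbb{T}_L=\mathbb{Z}^d/L\mathbb{Z}^d$ with nearest-neighbour edges $\mathcal{E}_L$. Let $i\in\{1,\dots,d\}$, let $N\in\mathbb{N}_{>0}$ and $\beta\geq 0$ be arbitrary, let $U:\mathbb{N}^{2N+1}\to\mathbb{R}_{\geq 0}$ be a weight function, and suppose that the measure $\mu_{(\mathbb{T}_L,\mathcal{E}_L),N,\beta,U}$ has finite mass. Then for every $z=(z_1,\dots,z_d)\in\mathbb{T}_L$ (with coordinates $z_j\in\{0,\dots,L-1\}$): if $z_i\in 2\mathbb{Z}+1$, then $$G_{L,N,\beta,U}(o,z)\leq G_{L,N,\beta,U}(o,z_i\boldsymbol{e}_i);$$ if $z_i\in 2\mathbb{Z}\setminus\{0\}$, then $$G_{L,N,\beta,U}(o,z)\leq \tfrac12 G_{L,N,\beta,U}\big(o,(z_i-1)\boldsymbol{e}_i\big)+\tfrac12 G_{L,N,\beta,U}\big(o,(z_i+1)\boldsymbol{e}_i\big).$$ Further, for every $y\in\mathbb{T}_L$ with $y\cdot\boldsymbol{e}_i=0$ (possibly $y=o$), the function $$n\mapsto G_{L,N,\beta,U}(o,y+n\boldsymbol{e}_i)+G_{L,N,\beta,U}(o,n\boldsymbol{e}_i)$$ is a non-increasing function of $n$ for odd $n$ in $(0,L/2)$.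
   Context: Random path model. $\mathbb{N}=\{0,1,2,\dots\}$. Let $\mathcal{G}=(\mathcal{V},\mathcal{E})$ be an undirected, simple, finite graph and $N\in\mathbb{N}_{>0}$ (number of colours). A link configuration is $m=(m_e)_{e\in\mathcal{E}}\in\mathbb{N}^{\mathcal{E}}$; $m_e$ is the number of links on $e$, and $(e,p)$, $1\leq p\leq m_e$, denotes the $p$-th link on $e$. A colouring of $m$ is $c=(c_e)_{e\in\mathcal{E}}$ with $c_e\in\{1,\dots,N\}^{m_e}$; $c_e(p)$ is the colour of the link $(e,p)$, and a link of colour $i$ is called an $i$-link. A link touches $x$ if it lies on an edge incident to $x$. A pairing for $(m,c)$ is $\pi=(\pi_x)_{x\in\mathcal{V}}$, where $\pi_x$ pairs some of the links touching $x$: each link touching $x$ is paired at $x$ to at most one other link touching $x$ (never to itself), links may be left unpaired at $x$, and two links paired at $x$ must have the same colour. A wire configuration is a triple $w=(m,c,\pi)$; $\mathcal{W}_{\mathcal{G}}$ is the set of all wire configurations. For $w\in\mathcal{W}_{\mathcal{G}}$, $x\in\mathcal{V}$, $i\in\{1,\dots,N\}$: $u^i_x(w)$ is the number of $i$-links touching $x$ which are not paired to any other link at $x$; $v^i_x(w)$ is the number of $i$-links touching $x$ which are paired at $x$ to another link; $n^i_x(w)=v^i_x(w)/2+u^i_x(w)$; $t_x(w)$ is the number of links incident to $x$ that are paired at $x$ with another link on the same edge. Write $\mathbf{n}_x=(n^1_x,\dots,n^N_x)$, $\mathbf{u}_x=(u^1_x,\dots,u^N_x)$. For $\beta\geq 0$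 and a weight function $U:\mathbb{N}^{2N+1}\to\mathbb{R}_{\geq 0}$, put $U_x(w)=U(\mathbf{n}_x(w),\mathbf{u}_x(w),t_x(w))$ and $$\mu_{\mathcal{G},N,\beta,U}(w)=\prod_{e\in\mathcal{E}}\frac{\beta^{m_e(w)}}{m_e(w)!}\prod_{x\in\mathcal{V}}U_x(w),\qquad w\in\mathcal{W}_{\mathcal{G}}.$$ It has finite mass if $\sum_{w}\mu_{\mathcal{G},N,\beta,U}(w)<\infty$. Two-point function. For $A\subset\mathcal{V}$, $\mathcal{S}_A$ is the set of $w$ with $u^1_x(w)=1$ for all $x\in A$ and $u^1_z(w)=0$ for all $z\in\mathcal{V}\setminus A$. For $x\in\mathcal{V}$, $\mathcal{R}_x$ is the set of $w$ with $u^1_x(w)=2$ and $u^1_z(w)=0$ for $z\neq x$. Set $Z_{\mathcal{G},N,\beta,U}(A)=\mu_{\mathcal{G},N,\beta,U}(\mathcal{S}_A)$, $Z_{\mathcal{G},N,\beta,U}(x,y)=Z_{\mathcal{G},N,\beta,U}(\{x,y\})$ for $x\neq y$, $Z_{\mathcal{G},N,\beta,U}(x,x)=\mu_{\mathcal{G},N,\beta,U}(\mathcal{R}_x)$, with the convention that $Z_{\mathcal{G},N,\beta,U}(\emptyset):=1$ if $\mu_{\mathcal{G},N,\beta,U}(\mathcal{S}_\emptyset)=0$. Define $$G_{\mathcal{G},N,\beta,U}(x,y)=\frac{Z_{\mathcal{G},N,\beta,U}(x,y)}{Z_{\mathcal{G},N,\beta,U}(\emptyset)}.$$ When $\mathcal{G}=(\mathbb{T}_L,\mathcal{E}_L)$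 one writes $G_{L,N,\beta,U}$ for $G_{\mathcal{G},N,\beta,U}$. The torus $\mathbb{T}_L$ is identified with $[0,L)^d\cap\mathbb{Z}^d$ (coordinates mod $L$); $o=(0,\dots,0)$; $\boldsymbol{e}_i$ are the cartesian unit vectors; $y\cdot\boldsymbol{e}_i$ is the $i$-th coordinate of $y$. *)

theory Defs
  imports "HOL-Analysis.Analysis"
begin

section \<open>The random path model\<close>

text \<open>
  A graph is given by a finite vertex set \<open>V\<close> and a set \<open>E\<close> of two-element subsets of \<open>V\<close>.
  Families indexed by edges, links or vertices are extensional functions, so that each
  configuration has exactly one representation and sums over configurations count it once.
\<close>

type_synonym 'v link = "'v set \<times> nat"

type_synonym 'v wire =
  "('v set \<Rightarrow> nat) \<times> ('v set \<Rightarrow> nat \<Rightarrow> nat) \<times> ('v \<Rightarrow> 'v link set set)"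

definition links_at :: "'v set set \<Rightarrow> ('v set \<Rightarrow> nat) \<Rightarrow> 'v \<Rightarrow> 'v link set" where
  "links_at E m x = {(e, p). e \<in> E \<and> x \<in> e \<and> 1 \<le> p \<and> p \<le> m e}"

text \<open>A pairing at \<open>x\<close> is the set of its pairs: disjoint two-element sets of links of equal colour.\<close>

definition pairings_at ::
  "'v set set \<Rightarrow> ('v set \<Rightarrow> nat) \<Rightarrow> ('v set \<Rightarrow> nat \<Rightarrow> nat) \<Rightarrow> 'v \<Rightarrow> 'v link set set set" where
  "pairings_at E m c x =
     {P. disjoint P \<and>
         P \<subseteq> {{a, b} | a b. a \<in> links_at E m x \<and> b \<in> links_at E m x \<and> a \<noteq> b
                         \<and> c (fst a) (snd a) = c (fst b) (snd b)}}"

definition wires :: "'v set \<Rightarrow> 'v set set \<Rightarrow> nat \<Rightarrow> 'v wire set" where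
  "wires V E N =
     {(m, c, \<pi>). m \<in> E \<rightarrow>\<^sub>E UNIV
              \<and> c \<in> (\<Pi>\<^sub>E e\<in>E. {1..m e} \<rightarrow>\<^sub>E {1..N})
              \<and> \<pi> \<in> (\<Pi>\<^sub>E x\<in>V. pairings_at E m c x)}"

text \<open>
  In the usual notation, \<open>unpaired\<close>, \<open>paired\<close>, \<open>local_time\<close> and \<open>same_edge_paired\<close> are
  \<open>u\<close>, \<open>v\<close>, \<open>n = v/2 + u\<close> and \<open>t\<close>.
\<close>

fun unpaired :: "'v set set \<Rightarrow> 'v wire \<Rightarrow> 'v \<Rightarrow> nat \<Rightarrow> nat" where
  "unpaired E (m, c, \<pi>) x k =
     card {l \<in> links_at E m x. c (fst l) (snd l) = k \<and> l \<notin> \<Union>(\<pi> x)}"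

fun paired :: "'v set set \<Rightarrow> 'v wire \<Rightarrow> 'v \<Rightarrow> nat \<Rightarrow> nat" where
  "paired E (m, c, \<pi>) x k =
     card {l \<in> links_at E m x. c (fst l) (snd l) = k \<and> l \<in> \<Union>(\<pi> x)}"

text \<open>The division is exact on wire configurations, see \<open>even_paired\<close> below.\<close>

definition local_time :: "'v set set \<Rightarrow> 'v wire \<Rightarrow> 'v \<Rightarrow> nat \<Rightarrow> nat" where
  "local_time E w x k = paired E w x k div 2 + unpaired E w x k"

fun same_edge_paired :: "'v set set \<Rightarrow> 'v wire \<Rightarrow> 'v \<Rightarrow> nat" where
  "same_edge_paired E (m, c, \<pi>) x =
     card {l \<in> links_at E m x. \<exists>l'. {l, l'} \<in> \<pi> x \<and> fst l' = fst l}"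

text \<open>
  A weight function on \<open>\<nat>\<^sup>2\<^sup>N\<^sup>+\<^sup>1\<close> takes two lists of length \<open>N\<close> (entries indexed by the
  colours \<open>1, \<dots>, N\<close>) and a natural number.
\<close>

type_synonym weight_fun = "nat list \<Rightarrow> nat list \<Rightarrow> nat \<Rightarrow> real"

definition vertex_weight ::
  "'v set set \<Rightarrow> nat \<Rightarrow> weight_fun \<Rightarrow> 'v wire \<Rightarrow> 'v \<Rightarrow> real" where
  "vertex_weight E N U w x =
     U (map (local_time E w x) [1..<Suc N]) (map (unpaired E w x) [1..<Suc N])
       (same_edge_paired E w x)"

definition wire_weight ::
  "'v set \<Rightarrow> 'v set set \<Rightarrow> nat \<Rightarrow> real \<Rightarrow> weight_fun \<Rightarrow> 'v wire \<Rightarrow> real" where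
  "wire_weight V E N \<beta> U w =
     (\<Prod>e\<in>E. \<beta> ^ fst w e / fact (fst w e)) * (\<Prod>x\<in>V. vertex_weight E N U w x)"

definition finite_mass ::
  "'v set \<Rightarrow> 'v set set \<Rightarrow> nat \<Rightarrow> real \<Rightarrow> weight_fun \<Rightarrow> bool" where
  "finite_mass V E N \<beta> U \<longleftrightarrow> wire_weight V E N \<beta> U summable_on wires V E N"

definition wire_measure ::
  "'v set \<Rightarrow> 'v set set \<Rightarrow> nat \<Rightarrow> real \<Rightarrow> weight_fun \<Rightarrow> 'v wire set \<Rightarrow> real" where
  "wire_measure V E N \<beta> U S = infsum (wire_weight V E N \<beta> U) S"

definition sources :: "'v set \<Rightarrow> 'v set set \<Rightarrow> nat \<Rightarrow> 'v set \<Rightarrow> 'v wire set" where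
  "sources V E N A =
     {w \<in> wires V E N. (\<forall>x\<in>A. unpaired E w x 1 = 1) \<and> (\<forall>z\<in>V - A. unpaired E w z 1 = 0)}"

definition double_source :: "'v set \<Rightarrow> 'v set set \<Rightarrow> nat \<Rightarrow> 'v \<Rightarrow> 'v wire set" where
  "double_source V E N x =
     {w \<in> wires V E N. unpaired E w x 1 = 2 \<and> (\<forall>z\<in>V - {x}. unpaired E w z 1 = 0)}"

definition Z_set ::
  "'v set \<Rightarrow> 'v set set \<Rightarrow> nat \<Rightarrow> real \<Rightarrow> weight_fun \<Rightarrow> 'v set \<Rightarrow> real" where
  "Z_set V E N \<beta> U A =
     (if A = {} \<and> wire_measure V E N \<beta> U (sources V E N {}) = 0 then 1
      else wire_measure V E N \<beta> U (sources V E N A))"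

definition Z_pair ::
  "'v set \<Rightarrow> 'v set set \<Rightarrow> nat \<Rightarrow> real \<Rightarrow> weight_fun \<Rightarrow> 'v \<Rightarrow> 'v \<Rightarrow> real" where
  "Z_pair V E N \<beta> U x y =
     (if x = y then wire_measure V E N \<beta> U (double_source V E N x)
      else Z_set V E N \<beta> U {x, y})"

definition two_point ::
  "'v set \<Rightarrow> 'v set set \<Rightarrow> nat \<Rightarrow> real \<Rightarrow> weight_fun \<Rightarrow> 'v \<Rightarrow> 'v \<Rightarrow> real" where
  "two_point V E N \<beta> U x y = Z_pair V E N \<beta> U x y / Z_set V E N \<beta> U {}"

section \<open>The torus\<close>

definition torus :: "nat \<Rightarrow> (int ^ 'd) set" where
  "torus L = {x. \<forall>j. 0 \<le> x $ j \<and> x $ j < int L}"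

definition wrap :: "nat \<Rightarrow> int ^ 'd \<Rightarrow> int ^ 'd" where
  "wrap L x = (\<chi> j. x $ j mod int L)"

text \<open>Edges are unordered and form a set, so for \<open>L = 2\<close> antipodal neighbours are joined by one edge.\<close>

definition torus_edges :: "nat \<Rightarrow> (int ^ 'd) set set" where
  "torus_edges L = {{x, wrap L (x + axis j 1)} | x j. x \<in> torus L}"

abbreviation torus_two_point ::
  "nat \<Rightarrow> nat \<Rightarrow> real \<Rightarrow> weight_fun \<Rightarrow> int ^ 'd \<Rightarrow> int ^ 'd \<Rightarrow> real" where
  "torus_two_point L \<equiv> two_point (torus L) (torus_edges L)"

section \<open>Well-formedness\<close>

lemma finite_torus: "finite (torus L :: (int ^ 'd::finite) set)"
proof -
  have "(torus L :: (int ^ 'd) set) \<subseteq> vec_lambda ` (UNIV \<rightarrow>\<^sub>E {0..<int L})"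
    by (auto simp: torus_def image_iff PiE_def extensional_def intro!: bexI[of _ "vec_nth _"])
  then show ?thesis
    by (rule finite_subset) (intro finite_imageI finite_PiE, auto)
qed

lemma torus_edges_simple:
  assumes "L \<ge> 2" and "e \<in> (torus_edges L :: (int ^ 'd::finite) set set)"
  shows "e \<subseteq> torus L" and "card e = 2"
proof -
  obtain x j where e: "e = {x, wrap L (x + axis j 1)}" and x: "x \<in> torus L"
    using assms(2) by (auto simp: torus_edges_def)
  show "e \<subseteq> torus L"
    using e x assms(1) by (auto simp: torus_def wrap_def)
  have b: "0 \<le> x $ j" "x $ j < int L" using x by (auto simp: torus_def)
  have "(x $ j + 1) mod int L \<noteq> x $ j"
  proof (cases "x $ j + 1 = int L")
    case True then show ?thesis using assms(1) by auto
  next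
    case False
    then have "(x $ j + 1) mod int L = x $ j + 1" using b by (intro mod_pos_pos_trivial) auto
    then show ?thesis by simp
  qed
  then have "wrap L (x + axis j 1) $ j \<noteq> x $ j" by (simp add: wrap_def axis_def)
  then have "x \<noteq> wrap L (x + axis j 1)" by metis
  then show "card e = 2" using e by simp
qed

lemma even_paired:
  assumes "finite E" and "(m, c, \<pi>) \<in> wires V E N" and "x \<in> V"
  shows "even (paired E (m, c, \<pi>) x k)"
proof -
  have P: "\<pi> x \<in> pairings_at E m c x" using assms by (auto simp: wires_def)
  define Q where "Q = {A \<in> \<pi> x. \<exists>l\<in>A. c (fst l) (snd l) = k}"
  have "links_at E m x \<subseteq> Sigma E (\<lambda>e. {1..m e})" by (auto simp: links_at_def)
  then have fin: "finite (links_at E m x)" by (rule finite_subset) (use assms(1) in auto)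
  have two: "\<exists>a b. A = {a, b} \<and> a \<noteq> b \<and> a \<in> links_at E m x \<and> b \<in> links_at E m x
      \<and> c (fst a) (snd a) = c (fst b) (snd b)" if "A \<in> \<pi> x" for A
    using P that unfolding pairings_at_def by blast
  have eq: "{l \<in> links_at E m x. c (fst l) (snd l) = k \<and> l \<in> \<Union>(\<pi> x)} = \<Union>Q"
  proof (rule set_eqI)
    fix l show "l \<in> {l \<in> links_at E m x. c (fst l) (snd l) = k \<and> l \<in> \<Union>(\<pi> x)} \<longleftrightarrow> l \<in> \<Union>Q"
    proof
      assume "l \<in> \<Union>Q"
      then obtain A where A: "A \<in> \<pi> x" "l \<in> A" "\<exists>l\<in>A. c (fst l) (snd l) = k"
        by (auto simp: Q_def)
      obtain a b where ab: "A = {a, b}" "a \<in> links_at E m x" "b \<in> links_at E m x"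
          "c (fst a) (snd a) = c (fst b) (snd b)" using two[OF A(1)] by blast
      then have "c (fst l) (snd l) = k" "l \<in> links_at E m x" using A by auto
      with A show "l \<in> {l \<in> links_at E m x. c (fst l) (snd l) = k \<and> l \<in> \<Union>(\<pi> x)}" by auto
    qed (auto simp: Q_def)
  qed
  have "disjoint Q" using P by (auto simp: pairings_at_def Q_def disjoint_def pairwise_def)
  moreover have c2: "card A = 2" if "A \<in> Q" for A
  proof -
    have "A \<in> \<pi> x" using that by (simp add: Q_def)
    from two[OF this] obtain a b where "A = {a, b}" "a \<noteq> b" by blast
    then show ?thesis by (metis card_2_iff)
  qed
  ultimately have "card (\<Union>Q) = (\<Sum>A\<in>Q. card A)"
    by (intro card_Union_disjoint) (use c2 in \<open>auto intro: card_ge_0_finite\<close>)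
  also have "\<dots> = 2 * card Q" using c2 by simp
  finally show ?thesis unfolding paired.simps eq by simp
qed

end

theory Submission imports Defs begin

text \<open>
  The theorem rests on reflection positivity. Reflect the torus in a pair of opposite hyperplanes
  that bisect edges. Every edge between the two halves is mapped to itself, so once the links on
  these crossing edges and their colours are given, the two halves of a wire configuration can be
  completed independently of each other, and completing one half is the mirror image of completing
  the other. For \<open>x\<close>, \<open>y\<close> in one half and the reflection \<open>\<theta>\<close>, the mass of the configurations with
  sources at \<open>x\<close> and \<open>\<theta> y\<close> is therefore an inner product \<open>\<Sum>k. F k x * F k y\<close> over the possible
  crossing data \<open>k\<close>, and the matrix with these entries is positive semidefinite
  (\<open>reflection_positive\<close>). This is proved for every finite graph with such a reflection.

  On the torus the same mass depends only on the displacement of the two sources and is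
  invariant under changing the sign of one coordinate, because translations and coordinate flips are
  graph automorphisms (\<open>wire_measure_relabel\<close>). If \<open>x\<close> and \<open>y\<close> have \<open>i\<close>-th coordinates \<open>a\<close> and \<open>b\<close>, the
  displacement from \<open>x\<close> to \<open>\<theta> y\<close> is, up to such symmetries, \<open>y - x\<close> with its \<open>i\<close>-th coordinate
  replaced by \<open>a + b + 1\<close> (\<open>mirror_pair_mass\<close>). Testing positivity on differences of point masses
  yields two midpoint inequalities (\<open>pair_mass_midpoint\<close>): the values at \<open>2a + 1\<close> and \<open>2b + 1\<close> on the
  axis add up to at least twice the value at any point of height \<open>a + b + 1\<close>, and the function
  \<open>n \<mapsto> G(o, y + n e) + G(o, n e)\<close> with \<open>y\<^sub>i = 0\<close> is convex along the odd numbers.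

  Now \<open>a = b\<close> is the bound for odd \<open>z\<^sub>i\<close>, and \<open>b = a + 1\<close> is the bound for even \<open>z\<^sub>i\<close>. A convex
  sequence that is also symmetric under \<open>n \<mapsto> L - n\<close> decreases up to its midpoint
  (\<open>convex_symmetric_antimono\<close>), which is the monotonicity statement.
\<close>

section \<open>Relabelling the vertices\<close>

definition relabel_link :: "('v \<Rightarrow> 'v) \<Rightarrow> 'v link \<Rightarrow> 'v link" where
  "relabel_link \<phi> l = (\<phi> ` fst l, snd l)"

text \<open>
  Taking preimages keeps the first two components extensional without any case distinction; the
  pairings need an explicit restriction because an image of \<open>undefined\<close> need not be \<open>undefined\<close>.
\<close>

definition relabel :: "('v \<Rightarrow> 'v) \<Rightarrow> 'v set \<Rightarrow> 'v wire \<Rightarrow> 'v wire" where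
  "relabel \<phi> V = (\<lambda>(m, c, \<pi>). (\<lambda>e. m (\<phi> -` e), \<lambda>e. c (\<phi> -` e),
     \<lambda>x\<in>\<phi> ` V. (`) (relabel_link \<phi>) ` \<pi> (inv \<phi> x)))"

lemma fst_relabel: "fst (relabel \<phi> V w) e = fst w (\<phi> -` e)"
  by (cases w) (simp add: relabel_def)

lemma relabel_link_sel [simp]:
  "fst (relabel_link \<phi> l) = \<phi> ` fst l" "snd (relabel_link \<phi> l) = snd l"
  by (simp_all add: relabel_link_def)

lemma inj_relabel_link: "inj \<phi> \<Longrightarrow> inj (relabel_link \<phi>)"
  by (auto intro!: injI simp: relabel_link_def prod_eq_iff inj_image_eq_iff)

lemma links_at_relabel:
  assumes "bij \<phi>"
  shows "links_at ((`) \<phi> ` E) (\<lambda>e. m (\<phi> -` e)) (\<phi> x) = relabel_link \<phi> ` links_at E m x"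
proof -
  have inj: "inj \<phi>" using assms by (rule bij_is_inj)
  have "links_at ((`) \<phi> ` E) (\<lambda>e. m (\<phi> -` e)) (\<phi> x)
      = {(\<phi> ` e, p) | e p. e \<in> E \<and> x \<in> e \<and> 1 \<le> p \<and> p \<le> m e}"
    unfolding links_at_def by (auto simp: inj_image_mem_iff[OF inj] inj_eq[OF inj] inj_vimage_image_eq[OF inj])
  also have "\<dots> = relabel_link \<phi> ` links_at E m x"
    by (force simp: links_at_def relabel_link_def)
  finally show ?thesis .
qed

lemma Collect_image_conj: "{y \<in> f ` A. Q y} = f ` {x \<in> A. Q (f x)}"
  by auto

lemma relabel_counts:
  assumes \<phi>: "bij \<phi>" and x: "x \<in> V"
  shows "unpaired ((`) \<phi> ` E) (relabel \<phi> V w) (\<phi> x) k = unpaired E w x k"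
    and "paired ((`) \<phi> ` E) (relabel \<phi> V w) (\<phi> x) k = paired E w x k"
    and "same_edge_paired ((`) \<phi> ` E) (relabel \<phi> V w) (\<phi> x) = same_edge_paired E w x"
proof -
  obtain m c \<pi> where w: "w = (m, c, \<pi>)" by (cases w)
  have inj: "inj \<phi>" using \<phi> by (rule bij_is_inj)
  note injl = inj_relabel_link[OF inj]
  have card: "card (relabel_link \<phi> ` A) = card A" for A
    by (rule card_image) (rule inj_on_subset[OF injl subset_UNIV])
  have same: "(\<exists>l'. {relabel_link \<phi> l, l'} \<in> (`) (relabel_link \<phi>) ` P \<and> fst l' = \<phi> ` fst l)
      \<longleftrightarrow> (\<exists>l'. {l, l'} \<in> P \<and> fst l' = fst l)" (is "?L \<longleftrightarrow> ?R") for l P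
  proof
    assume ?L
    then obtain l' p where p: "p \<in> P" "{relabel_link \<phi> l, l'} = relabel_link \<phi> ` p"
      and f: "fst l' = \<phi> ` fst l" by auto
    have "l' \<in> relabel_link \<phi> ` p" unfolding p(2)[symmetric] by simp
    then obtain l0 where l0: "l' = relabel_link \<phi> l0" by blast
    have "relabel_link \<phi> ` p = relabel_link \<phi> ` {l, l0}" using p(2) l0 by simp
    then have "p = {l, l0}" unfolding inj_image_eq_iff[OF injl] .
    moreover have "fst l0 = fst l" using f l0 inj by (simp add: inj_image_eq_iff)
    ultimately show ?R using p(1) by blast
  next
    assume ?R
    then obtain l' where "{l, l'} \<in> P" "fst l' = fst l" by auto
    then have "relabel_link \<phi> ` {l, l'} \<in> (`) (relabel_link \<phi>) ` P"
      and "fst (relabel_link \<phi> l') = \<phi> ` fst l" by (blast, simp)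
    then show ?L by (intro exI[of _ "relabel_link \<phi> l'"]) simp
  qed
  show "unpaired ((`) \<phi> ` E) (relabel \<phi> V w) (\<phi> x) k = unpaired E w x k"
    "paired ((`) \<phi> ` E) (relabel \<phi> V w) (\<phi> x) k = paired E w x k"
    "same_edge_paired ((`) \<phi> ` E) (relabel \<phi> V w) (\<phi> x) = same_edge_paired E w x"
    unfolding w using x inj
    by (simp_all add: relabel_def links_at_relabel[OF \<phi>] Collect_image_conj card inj_image_mem_iff[OF injl] same
        inj_vimage_image_eq del: split_paired_Ex)
qed

lemma relabel_vertex_weight:
  assumes "bij \<phi>" and "x \<in> V"
  shows "vertex_weight ((`) \<phi> ` E) N U (relabel \<phi> V w) (\<phi> x) = vertex_weight E N U w x"
proof -
  have "local_time ((`) \<phi> ` E) (relabel \<phi> V w) (\<phi> x) = local_time E w x"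
    "unpaired ((`) \<phi> ` E) (relabel \<phi> V w) (\<phi> x) = unpaired E w x"
    by (simp_all add: fun_eq_iff local_time_def relabel_counts[OF assms])
  then show ?thesis by (simp add: vertex_weight_def relabel_counts[OF assms])
qed

lemma relabel_wires:
  assumes \<phi>: "bij \<phi>" and w: "w \<in> wires V E N"
  shows "relabel \<phi> V w \<in> wires (\<phi> ` V) ((`) \<phi> ` E) N"
proof -
  obtain m c \<pi> where mc: "w = (m, c, \<pi>)" by (cases w)
  have inj: "inj \<phi>" using \<phi> by (rule bij_is_inj)
  note injl = inj_relabel_link[OF inj]
  have vim: "\<phi> -` e \<in> E \<longleftrightarrow> e \<in> (`) \<phi> ` E" for e
  proof
    assume "\<phi> -` e \<in> E"
    moreover have "\<phi> ` (\<phi> -` e) = e" by (rule surj_image_vimage_eq[OF bij_is_surj[OF \<phi>]])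
    ultimately show "e \<in> (`) \<phi> ` E" by (metis imageI)
  qed (auto simp: inj_vimage_image_eq[OF inj])
  have m: "m \<in> E \<rightarrow>\<^sub>E UNIV" and c: "c \<in> (\<Pi>\<^sub>E e\<in>E. {1..m e} \<rightarrow>\<^sub>E {1..N})"
    and p: "\<pi> \<in> (\<Pi>\<^sub>E x\<in>V. pairings_at E m c x)"
    using w by (auto simp: wires_def mc)
  have "(`) (relabel_link \<phi>) ` P \<in> pairings_at ((`) \<phi> ` E) (\<lambda>e. m (\<phi> -` e)) (\<lambda>e. c (\<phi> -` e)) (\<phi> x)"
    if P: "P \<in> pairings_at E m c x" for P x
  proof -
    have "disjoint ((`) (relabel_link \<phi>) ` P)"
      using P injl by (intro disjoint_image) (auto simp: pairings_at_def intro: inj_on_subset)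
    moreover have "relabel_link \<phi> ` q \<in> {{a, b} | a b. a \<in> links_at ((`) \<phi> ` E) (\<lambda>e. m (\<phi> -` e)) (\<phi> x)
         \<and> b \<in> links_at ((`) \<phi> ` E) (\<lambda>e. m (\<phi> -` e)) (\<phi> x) \<and> a \<noteq> b
         \<and> c (\<phi> -` fst a) (snd a) = c (\<phi> -` fst b) (snd b)}" if "q \<in> P" for q
    proof -
      obtain a b where q: "q = {a, b}" "a \<in> links_at E m x" "b \<in> links_at E m x" "a \<noteq> b"
        "c (fst a) (snd a) = c (fst b) (snd b)"
        using P \<open>q \<in> P\<close> unfolding pairings_at_def by blast
      have "relabel_link \<phi> a \<in> links_at ((`) \<phi> ` E) (\<lambda>e. m (\<phi> -` e)) (\<phi> x)"
        "relabel_link \<phi> b \<in> links_at ((`) \<phi> ` E) (\<lambda>e. m (\<phi> -` e)) (\<phi> x)"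
        using q by (simp_all add: links_at_relabel[OF \<phi>])
      moreover have "relabel_link \<phi> a \<noteq> relabel_link \<phi> b"
        using q(4) injl by (simp add: inj_eq)
      moreover have "c (\<phi> -` fst (relabel_link \<phi> a)) (snd (relabel_link \<phi> a))
          = c (\<phi> -` fst (relabel_link \<phi> b)) (snd (relabel_link \<phi> b))"
        using q(5) inj by (simp add: inj_vimage_image_eq)
      ultimately show ?thesis unfolding q(1) image_insert image_empty by blast
    qed
    ultimately show ?thesis unfolding pairings_at_def by blast
  qed
  moreover have "c (\<phi> -` e) \<in> {1..m (\<phi> -` e)} \<rightarrow>\<^sub>E {1..N}" if "e \<in> (`) \<phi> ` E" for e
    using c vim that by blast
  moreover have "c (\<phi> -` e) = undefined" "m (\<phi> -` e) = undefined" if "e \<notin> (`) \<phi> ` E" for e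
    using c m vim that by (meson PiE_E)+
  ultimately show ?thesis
    using p inj unfolding wires_def mc relabel_def
    by (auto simp: PiE_iff extensional_def Pi_iff)
qed

lemma relabel_inverse:
  assumes \<phi>: "bij \<phi>" and w: "w \<in> wires V E N"
  shows "relabel (inv \<phi>) (\<phi> ` V) (relabel \<phi> V w) = w"
proof -
  obtain m c \<pi> where mc: "w = (m, c, \<pi>)" by (cases w)
  have inj: "inj \<phi>" and surj: "surj \<phi>" using \<phi> by (auto simp: bij_def)
  have v: "\<phi> -` inv \<phi> -` e = e" for e
    using inj by (simp add: vimage_def)
  have l: "(`) (relabel_link (inv \<phi>)) ` (`) (relabel_link \<phi>) ` P = P" for P
  proof -
    have "relabel_link (inv \<phi>) (relabel_link \<phi> l) = l" for l
      using inj by (simp add: relabel_link_def image_image)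
    then show ?thesis by (simp add: image_image)
  qed
  have "\<pi> x = undefined" if "x \<notin> V" for x
    using w that by (auto simp: wires_def mc)
  then show ?thesis
    using inj by (auto simp: mc relabel_def v l fun_eq_iff restrict_def inv_inv_eq[OF \<phi>])
qed

lemma bij_betw_relabel:
  assumes \<phi>: "bij \<phi>"
  shows "bij_betw (relabel \<phi> V) (wires V E N) (wires (\<phi> ` V) ((`) \<phi> ` E) N)"
proof (rule bij_betw_byWitness[of _ "relabel (inv \<phi>) (\<phi> ` V)"])
  have inv: "bij (inv \<phi>)" using \<phi> by (rule bij_imp_bij_inv)
  have inj: "inj \<phi>" using \<phi> by (rule bij_is_inj)
  have V: "inv \<phi> ` \<phi> ` V = V" and E: "(`) (inv \<phi>) ` (`) \<phi> ` E = E"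
    using inj by (simp_all add: image_image)
  show "\<forall>w\<in>wires V E N. relabel (inv \<phi>) (\<phi> ` V) (relabel \<phi> V w) = w"
    using relabel_inverse[OF \<phi>] by blast
  show "\<forall>w\<in>wires (\<phi> ` V) ((`) \<phi> ` E) N. relabel \<phi> V (relabel (inv \<phi>) (\<phi> ` V) w) = w"
    using relabel_inverse[OF inv, of _ "\<phi> ` V"] unfolding V inv_inv_eq[OF \<phi>] by blast
  show "relabel \<phi> V ` wires V E N \<subseteq> wires (\<phi> ` V) ((`) \<phi> ` E) N"
    using relabel_wires[OF \<phi>] by blast
  show "relabel (inv \<phi>) (\<phi> ` V) ` wires (\<phi> ` V) ((`) \<phi> ` E) N \<subseteq> wires V E N"
    using relabel_wires[OF inv, of _ "\<phi> ` V" "(`) \<phi> ` E" N] unfolding V E by blast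
qed

lemma relabel_sources:
  assumes \<phi>: "bij \<phi>" and w: "w \<in> wires V E N" and A: "A \<subseteq> V"
  shows "relabel \<phi> V w \<in> sources (\<phi> ` V) ((`) \<phi> ` E) N (\<phi> ` A) \<longleftrightarrow> w \<in> sources V E N A"
proof -
  have V: "\<phi> ` V - \<phi> ` A = \<phi> ` (V - A)"
    using bij_is_inj[OF \<phi>] by (simp add: image_set_diff)
  have u: "unpaired ((`) \<phi> ` E) (relabel \<phi> V w) (\<phi> x) 1 = unpaired E w x 1" if "x \<in> V" for x
    by (rule relabel_counts[OF \<phi> that])
  have "(\<forall>x\<in>A. unpaired ((`) \<phi> ` E) (relabel \<phi> V w) (\<phi> x) 1 = 1) \<longleftrightarrow> (\<forall>x\<in>A. unpaired E w x 1 = 1)"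
    using u A by (metis subsetD)
  moreover have "(\<forall>x\<in>V - A. unpaired ((`) \<phi> ` E) (relabel \<phi> V w) (\<phi> x) 1 = 0)
      \<longleftrightarrow> (\<forall>x\<in>V - A. unpaired E w x 1 = 0)"
    using u by (metis DiffD1)
  ultimately show ?thesis
    using w relabel_wires[OF \<phi> w] unfolding sources_def V by simp
qed

lemma relabel_wire_weight:
  assumes \<phi>: "bij \<phi>"
  shows "wire_weight (\<phi> ` V) ((`) \<phi> ` E) N \<beta> U (relabel \<phi> V w) = wire_weight V E N \<beta> U w"
proof -
  have inj: "inj \<phi>" using \<phi> by (rule bij_is_inj)
  have 1: "inj_on ((`) \<phi>) E" and 2: "inj_on \<phi> V"
    by (simp_all add: inj_on_def inj_image_eq_iff[OF inj] inj_eq[OF inj])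
  show ?thesis
    unfolding wire_weight_def prod.reindex[OF 1] prod.reindex[OF 2] o_def fst_relabel
    using inj by (simp add: relabel_vertex_weight[OF \<phi>] inj_vimage_image_eq)
qed

text \<open>
  The model only sees the incidence structure. The statement covers graph automorphisms, where
  \<open>\<phi>\<close> maps \<open>V\<close> and \<open>E\<close> to themselves.
\<close>

lemma wire_measure_relabel:
  fixes \<phi> :: "'v \<Rightarrow> 'v"
  assumes \<phi>: "bij \<phi>" and A: "A \<subseteq> V"
  shows "wire_measure (\<phi> ` V) ((`) \<phi> ` E) N \<beta> U (sources (\<phi> ` V) ((`) \<phi> ` E) N (\<phi> ` A))
    = wire_measure V E N \<beta> U (sources V E N A)"
proof -
  have s: "sources V E N A = {w \<in> wires V E N. w \<in> sources V E N A}" for V :: "'v set" and E A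
    by (auto simp: sources_def)
  have "bij_betw (relabel \<phi> V) {w \<in> wires V E N. w \<in> sources V E N A}
      {w \<in> wires (\<phi> ` V) ((`) \<phi> ` E) N. w \<in> sources (\<phi> ` V) ((`) \<phi> ` E) N (\<phi> ` A)}"
    by (rule bij_betw_Collect[OF bij_betw_relabel[OF \<phi>]]) (rule relabel_sources[OF \<phi> _ A])
  then have "bij_betw (relabel \<phi> V) (sources V E N A) (sources (\<phi> ` V) ((`) \<phi> ` E) N (\<phi> ` A))"
    unfolding s[symmetric] .
  then have "infsum (\<lambda>w. wire_weight (\<phi> ` V) ((`) \<phi> ` E) N \<beta> U (relabel \<phi> V w)) (sources V E N A)
      = infsum (wire_weight (\<phi> ` V) ((`) \<phi> ` E) N \<beta> U) (sources (\<phi> ` V) ((`) \<phi> ` E) N (\<phi> ` A))"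
    by (rule infsum_reindex_bij_betw)
  then show ?thesis by (simp add: wire_measure_def relabel_wire_weight[OF \<phi>])
qed

section \<open>Cutting a configuration into two halves\<close>

text \<open>
  A half of a graph is a vertex set \<open>V'\<close> together with the set \<open>E'\<close> of all edges that meet it. The
  edges in \<open>E'\<close> may have endpoints outside \<open>V'\<close>; pairings are only recorded at the vertices of \<open>V'\<close>,
  so links on crossing edges occur in both halves and are paired in each half on one side only.
\<close>

definition cut_wire :: "'v set \<Rightarrow> 'v set set \<Rightarrow> 'v wire \<Rightarrow> 'v wire" where
  "cut_wire V E = (\<lambda>(m, c, \<pi>). (restrict m E, restrict c E, restrict \<pi> V))"

text \<open>
  The trace is what one half knows about the crossing edges \<open>R\<close>; two halves fit together exactly
  when their traces agree.
\<close>

definition trace_on ::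
  "'v set set \<Rightarrow> 'v wire \<Rightarrow> ('v set \<Rightarrow> nat) \<times> ('v set \<Rightarrow> nat \<Rightarrow> nat)" where
  "trace_on R w = (restrict (fst w) R, restrict (fst (snd w)) R)"

definition glue :: "'v set \<Rightarrow> 'v set set \<Rightarrow> 'v wire \<Rightarrow> 'v wire \<Rightarrow> 'v wire" where
  "glue V E = (\<lambda>(m, c, \<pi>) (m', c', \<pi>').
     (\<lambda>e. if e \<in> E then m e else m' e, \<lambda>e. if e \<in> E then c e else c' e,
      \<lambda>x. if x \<in> V then \<pi> x else \<pi>' x))"

lemma fst_cut: "e \<in> E \<Longrightarrow> fst (cut_wire V E w) e = fst w e"
  by (cases w) (simp add: cut_wire_def)

lemma links_at_restrict:
  assumes "E' \<subseteq> E" and "\<And>e. e \<in> E \<Longrightarrow> x \<in> e \<Longrightarrow> e \<in> E'"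
  shows "links_at E' (restrict m E') x = links_at E m x"
  using assms by (auto simp: links_at_def)

text \<open>All data at a vertex are determined by the edges that contain it.\<close>

lemma pairings_at_restrict:
  assumes "E' \<subseteq> E" and "\<And>e. e \<in> E \<Longrightarrow> x \<in> e \<Longrightarrow> e \<in> E'"
  shows "pairings_at E' (restrict m E') (restrict c E') x = pairings_at E m c x"
proof -
  have r: "restrict c E' (fst a) = c (fst a)" if "a \<in> links_at E m x" for a
    using that assms(2) by (auto simp: links_at_def)
  have eq: "(a \<in> links_at E m x \<and> b \<in> links_at E m x \<and> a \<noteq> b
          \<and> restrict c E' (fst a) (snd a) = restrict c E' (fst b) (snd b))
      \<longleftrightarrow> (a \<in> links_at E m x \<and> b \<in> links_at E m x \<and> a \<noteq> b
          \<and> c (fst a) (snd a) = c (fst b) (snd b))" for a b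
    using r by metis
  show ?thesis by (simp only: pairings_at_def links_at_restrict[OF assms, of _ m] eq)
qed

lemma cut_counts:
  assumes E: "E' \<subseteq> E" "\<And>e. e \<in> E \<Longrightarrow> x \<in> e \<Longrightarrow> e \<in> E'" and x: "x \<in> V'"
  shows "unpaired E' (cut_wire V' E' w) x k = unpaired E w x k"
    and "paired E' (cut_wire V' E' w) x k = paired E w x k"
    and "same_edge_paired E' (cut_wire V' E' w) x = same_edge_paired E w x"
proof -
  obtain m c \<pi> where w: "w = (m, c, \<pi>)" by (cases w)
  have "restrict c E' (fst l) = c (fst l)" if "l \<in> links_at E m x" for l
    using that E(2) by (auto simp: links_at_def)
  then show "unpaired E' (cut_wire V' E' w) x k = unpaired E w x k"
    "paired E' (cut_wire V' E' w) x k = paired E w x k"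
    "same_edge_paired E' (cut_wire V' E' w) x = same_edge_paired E w x"
    unfolding w using x
    by (simp_all add: cut_wire_def links_at_restrict[OF E] cong: conj_cong)
qed

lemma cut_vertex_weight:
  assumes "E' \<subseteq> E" "\<And>e. e \<in> E \<Longrightarrow> x \<in> e \<Longrightarrow> e \<in> E'" and "x \<in> V'"
  shows "vertex_weight E' N U (cut_wire V' E' w) x = vertex_weight E N U w x"
proof -
  have "local_time E' (cut_wire V' E' w) x = local_time E w x"
    "unpaired E' (cut_wire V' E' w) x = unpaired E w x"
    by (simp_all add: fun_eq_iff local_time_def cut_counts[OF assms])
  then show ?thesis by (simp add: vertex_weight_def cut_counts[OF assms])
qed

lemma cut_wires:
  assumes "E' \<subseteq> E" and "\<And>e x. e \<in> E \<Longrightarrow> x \<in> V' \<Longrightarrow> x \<in> e \<Longrightarrow> e \<in> E'" and "V' \<subseteq> V"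
    and "w \<in> wires V E N"
  shows "cut_wire V' E' w \<in> wires V' E' N"
proof -
  obtain m c \<pi> where w: "w = (m, c, \<pi>)" by (cases w)
  have "pairings_at E' (restrict m E') (restrict c E') x = pairings_at E m c x" if "x \<in> V'" for x
    using assms(1) assms(2)[OF _ that] by (rule pairings_at_restrict)
  then show ?thesis using assms(1,3,4) unfolding w by (auto simp: wires_def cut_wire_def PiE_iff)
qed

text \<open>
  Pairings are local to vertices, so agreement on the common edges is the only constraint between
  the two pieces. The inverse map is \<open>glue\<close>.
\<close>

lemma bij_betw_cut:
  assumes V: "V = V1 \<union> V2" "V1 \<inter> V2 = {}" and E: "E = E1 \<union> E2"
    and i1: "\<And>e x. e \<in> E \<Longrightarrow> x \<in> V1 \<Longrightarrow> x \<in> e \<Longrightarrow> e \<in> E1"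
    and i2: "\<And>e x. e \<in> E \<Longrightarrow> x \<in> V2 \<Longrightarrow> x \<in> e \<Longrightarrow> e \<in> E2"
  shows "bij_betw (\<lambda>w. (cut_wire V1 E1 w, cut_wire V2 E2 w)) (wires V E N)
    {(w1, w2) \<in> wires V1 E1 N \<times> wires V2 E2 N. trace_on (E1 \<inter> E2) w1 = trace_on (E1 \<inter> E2) w2}"
    (is "bij_betw ?f _ ?P")
proof (rule bij_betw_byWitness[of _ "\<lambda>(w1, w2). glue V1 E1 w1 w2"])
  have tr: "trace_on (E1 \<inter> E2) (cut_wire V1 E1 w) = trace_on (E1 \<inter> E2) (cut_wire V2 E2 w)"
    for w :: "'a wire"
    by (cases w) (auto simp: trace_on_def cut_wire_def fun_eq_iff)
  show "?f ` wires V E N \<subseteq> ?P"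
  proof (intro image_subsetI)
    fix w assume "w \<in> wires V E N"
    then have "cut_wire V1 E1 w \<in> wires V1 E1 N" "cut_wire V2 E2 w \<in> wires V2 E2 N"
      using i1 i2 V E by (auto intro!: cut_wires[of _ E _ V])
    then show "?f w \<in> ?P" using tr by simp
  qed
  show "\<forall>w\<in>wires V E N. (case ?f w of (w1, w2) \<Rightarrow> glue V1 E1 w1 w2) = w"
  proof
    fix w assume w: "w \<in> wires V E N"
    obtain m c \<pi> where mc: "w = (m, c, \<pi>)" by (cases w)
    have "m e = undefined \<and> c e = undefined" if "e \<notin> E1" "e \<notin> E2" for e
      using w that by (auto simp: mc wires_def E)
    moreover have "\<pi> x = undefined" if "x \<notin> V1" "x \<notin> V2" for x
      using w that by (auto simp: mc wires_def V)
    ultimately show "(case ?f w of (w1, w2) \<Rightarrow> glue V1 E1 w1 w2) = w"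
      by (auto simp: mc cut_wire_def glue_def fun_eq_iff)
  qed
  have glue: "glue V1 E1 w1 w2 \<in> wires V E N \<and> ?f (glue V1 E1 w1 w2) = (w1, w2)"
    if P: "(w1, w2) \<in> ?P" for w1 w2
  proof -
    obtain m1 c1 \<pi>1 where w1: "w1 = (m1, c1, \<pi>1)" by (cases w1)
    obtain m2 c2 \<pi>2 where w2: "w2 = (m2, c2, \<pi>2)" by (cases w2)
    define m where "m = (\<lambda>e. if e \<in> E1 then m1 e else m2 e)"
    define c where "c = (\<lambda>e. if e \<in> E1 then c1 e else c2 e)"
    define \<pi> where "\<pi> = (\<lambda>x. if x \<in> V1 then \<pi>1 x else \<pi>2 x)"
    have w: "glue V1 E1 w1 w2 = (m, c, \<pi>)"
      by (simp add: glue_def w1 w2 m_def c_def \<pi>_def)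
    have eq: "m1 e = m2 e" "c1 e = c2 e" if "e \<in> E1" "e \<in> E2" for e
      using P that by (auto simp: w1 w2 trace_on_def fun_eq_iff restrict_def split: if_splits)
    have o1: "m1 e = undefined" "c1 e = undefined" if "e \<notin> E1" for e
      using P that by (auto simp: w1 wires_def)
    have o2: "m2 e = undefined" "c2 e = undefined" if "e \<notin> E2" for e
      using P that by (auto simp: w2 wires_def)
    have o: "x \<notin> V1 \<Longrightarrow> \<pi>1 x = undefined" "x \<notin> V2 \<Longrightarrow> \<pi>2 x = undefined" for x
      using P by (auto simp: w1 w2 wires_def)
    have r: "restrict m E1 = m1" "restrict c E1 = c1" "restrict m E2 = m2" "restrict c E2 = c2"
      "restrict \<pi> V1 = \<pi>1" "restrict \<pi> V2 = \<pi>2"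
      by (rule ext; use V(2) in \<open>auto simp: m_def c_def \<pi>_def restrict_def eq o1 o2 o\<close>)+
    have "w1 \<in> wires V1 E1 N" "w2 \<in> wires V2 E2 N" using P by auto
    then have W1: "c1 \<in> (\<Pi>\<^sub>E e\<in>E1. {1..m1 e} \<rightarrow>\<^sub>E {1..N})" "\<pi>1 \<in> (\<Pi>\<^sub>E x\<in>V1. pairings_at E1 m1 c1 x)"
      and W2: "c2 \<in> (\<Pi>\<^sub>E e\<in>E2. {1..m2 e} \<rightarrow>\<^sub>E {1..N})" "\<pi>2 \<in> (\<Pi>\<^sub>E x\<in>V2. pairings_at E2 m2 c2 x)"
      by (simp_all add: wires_def w1 w2)
    have p1: "pairings_at E1 m1 c1 x = pairings_at E m c x" if "x \<in> V1" for x
      using pairings_at_restrict[of E1 E x m c] that i1 E unfolding r by blast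
    have p2: "pairings_at E2 m2 c2 x = pairings_at E m c x" if "x \<in> V2" for x
      using pairings_at_restrict[of E2 E x m c] that i2 E unfolding r by blast
    have at: "m e = m1 e" "c e = c1 e" if "e \<in> E1" for e
      using that by (auto simp: m_def c_def)
    have at': "m e = m2 e" "c e = c2 e" if "e \<in> E2" for e
      using r that by (metis restrict_apply')+
    have "m e = undefined" "c e = undefined" if "e \<notin> E" for e
      using that o2 by (auto simp: m_def c_def E)
    moreover have "c e \<in> {1..m e} \<rightarrow>\<^sub>E {1..N}" if "e \<in> E" for e
    proof (cases "e \<in> E1")
      case True
      then show ?thesis using PiE_mem[OF W1(1)] at by simp
    next
      case False
      then have "e \<in> E2" using that E by blast
      then show ?thesis using PiE_mem[OF W2(1)] at' by simp
    qed
    moreover have "\<pi> x \<in> pairings_at E m c x" if "x \<in> V" for x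
    proof (cases "x \<in> V1")
      case True
      then have "\<pi> x = \<pi>1 x" using True by (simp add: \<pi>_def)
      then show ?thesis using PiE_mem[OF W1(2) True] p1[OF True] by simp
    next
      case False
      then have x: "x \<in> V2" using that V by blast
      have "\<pi> x = \<pi>2 x" using False by (simp add: \<pi>_def)
      then show ?thesis using PiE_mem[OF W2(2) x] p2[OF x] by simp
    qed
    moreover have "\<pi> x = undefined" if "x \<notin> V" for x
      using that o by (auto simp: \<pi>_def V)
    ultimately have "(m, c, \<pi>) \<in> wires V E N"
      by (auto simp: wires_def PiE_iff extensional_def)
    then show ?thesis using r unfolding w by (simp add: cut_wire_def w1 w2)
  qed
  show "\<forall>p\<in>?P. ?f (case p of (w1, w2) \<Rightarrow> glue V1 E1 w1 w2) = p"
    using glue by fast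
  show "(\<lambda>(w1, w2). glue V1 E1 w1 w2) ` ?P \<subseteq> wires V E N"
  proof (rule image_subsetI)
    fix p assume "p \<in> ?P"
    then show "(case p of (w1, w2) \<Rightarrow> glue V1 E1 w1 w2) \<in> wires V E N"
      using glue[of "fst p" "snd p"] by (cases p) simp
  qed
qed

section \<open>Positivity of sums over fibre pairs\<close>

text \<open>
  Grouping the pairs by the common value \<open>k\<close> of \<open>r\<close> gives \<open>\<Sum>k. (\<Sum>w | r w = k. a w)\<^sup>2\<close>.
  Summability is required over the pairs alone: on the reals \<open>infsum\<close> commutes with
  multiplication by a constant even where \<open>a\<close> is not summable on a fibre.
\<close>

lemma infsum_fibre_pairs_nonneg:
  fixes a :: "'a \<Rightarrow> real" and r :: "'a \<Rightarrow> 'b"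
  assumes sum: "(\<lambda>(w, w'). a w * a w') summable_on {(w, w'). w \<in> W \<and> w' \<in> W \<and> r w = r w'}"
  shows "infsum (\<lambda>(w, w'). a w * a w') {(w, w'). w \<in> W \<and> w' \<in> W \<and> r w = r w'} \<ge> 0"
proof -
  define D where "D k = {w \<in> W. r w = k}" for k
  let ?P = "{(w, w'). w \<in> W \<and> w' \<in> W \<and> r w = r w'}"
  let ?f = "\<lambda>(k, w, w'). a w * a w' :: real"
  have bij: "bij_betw (\<lambda>(w, w'). (r w, w, w')) ?P (Sigma UNIV (\<lambda>k. D k \<times> D k))"
    by (auto simp: bij_betw_def inj_on_def D_def)
  have eq: "?f ((\<lambda>(w, w'). (r w, w, w')) q) = (\<lambda>(w, w'). a w * a w') q" for q
    by (cases q) auto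
  have sum': "?f summable_on Sigma UNIV (\<lambda>k. D k \<times> D k)"
    using summable_on_reindex_bij_betw[OF bij, of ?f] sum unfolding eq by simp
  have fib: "infsum (\<lambda>y. ?f (k, y)) (D k \<times> D k) = (infsum a (D k))\<^sup>2" for k
  proof -
    have "(\<lambda>(w, w'). a w * a w') summable_on D k \<times> D k"
      by (rule summable_on_subset_banach[OF sum]) (auto simp: D_def)
    from infsum_Sigma'_banach[OF this]
    show ?thesis by (simp add: infsum_cmult_right' infsum_cmult_left' power2_eq_square)
  qed
  have "infsum (\<lambda>(w, w'). a w * a w') ?P = infsum ?f (Sigma UNIV (\<lambda>k. D k \<times> D k))"
    using infsum_reindex_bij_betw[OF bij, of ?f] unfolding eq by simp
  also have "\<dots> = infsum (\<lambda>k. infsum (\<lambda>y. ?f (k, y)) (D k \<times> D k)) UNIV"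
    using infsum_Sigma_banach[OF sum'] by simp
  also have "\<dots> \<ge> 0" unfolding fib by (rule infsum_nonneg) simp
  finally show ?thesis .
qed

lemma has_sum_finite_sum:
  fixes f :: "'i \<Rightarrow> 'a \<Rightarrow> real"
  assumes "\<And>i. i \<in> I \<Longrightarrow> (f i has_sum s i) A"
  shows "((\<lambda>w. \<Sum>i\<in>I. f i w) has_sum (\<Sum>i\<in>I. s i)) A"
  using assms
proof (induction I rule: infinite_finite_induct)
  case (insert i I)
  then show ?case by (simp add: has_sum_add)
qed simp_all

section \<open>Reflection positivity\<close>

text \<open>
  The decisive condition is \<open>crossing_fixed\<close>: an edge that leaves the half \<open>Vp\<close> is mapped to
  itself, so on a simple graph it joins a vertex to its own mirror image. Reflecting then does not change the data on the crossing edges, and these can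
  serve as a common boundary condition for both halves.
\<close>

locale reflected_graph =
  fixes V :: "'v set" and E :: "'v set set" and \<theta> :: "'v \<Rightarrow> 'v" and Vp :: "'v set"
  assumes finite_V: "finite V" and finite_E: "finite E"
    and edge_nonempty: "e \<in> E \<Longrightarrow> e \<noteq> {}" and edge_subset: "e \<in> E \<Longrightarrow> e \<subseteq> V"
    and involution [simp]: "\<theta> (\<theta> x) = x"
    and edges_reflect: "e \<in> E \<Longrightarrow> \<theta> ` e \<in> E"
    and half_subset: "Vp \<subseteq> V" and half_reflect: "\<theta> ` Vp = V - Vp"
    and crossing_fixed: "e \<in> E \<Longrightarrow> x \<in> e \<Longrightarrow> x \<in> Vp \<Longrightarrow> y \<in> e \<Longrightarrow> y \<notin> Vp \<Longrightarrow> \<theta> ` e = e"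
begin

definition "Vm = V - Vp"
definition "Ep = {e \<in> E. e \<inter> Vp \<noteq> {}}"
definition "Em = {e \<in> E. e \<inter> Vm \<noteq> {}}"

lemma bij_reflection: "bij \<theta>"
  by (rule o_bij[of \<theta>]) (auto simp: fun_eq_iff)

lemma image_involution [simp]: "\<theta> ` \<theta> ` A = A"
  by (simp add: image_image)

lemma vimage_reflection: "\<theta> -` A = \<theta> ` A"
  by (auto intro: rev_image_eqI)

lemma reflect_Vm: "\<theta> ` Vm = Vp"
  unfolding Vm_def half_reflect[symmetric] by simp

lemma E_eq: "E = Ep \<union> Em"
proof (intro subset_antisym subsetI)
  fix e assume e: "e \<in> E"
  then obtain x where x: "x \<in> e" "x \<in> V" using edge_nonempty edge_subset by blast
  show "e \<in> Ep \<union> Em"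
  proof (cases "x \<in> Vp")
    case True
    then show ?thesis using e x(1) unfolding Ep_def by blast
  next
    case False
    then show ?thesis using e x unfolding Em_def Vm_def by blast
  qed
next
  fix e assume "e \<in> Ep \<union> Em"
  then show "e \<in> E" unfolding Ep_def Em_def by blast
qed

lemma reflect_Em: "(`) \<theta> ` Em = Ep"
proof -
  have 1: "\<theta> ` e \<inter> Vp \<noteq> {} \<longleftrightarrow> e \<inter> Vm \<noteq> {}" for e
  proof -
    have "\<theta> ` e \<inter> Vp = \<theta> ` (e \<inter> Vm)"
      using image_Int[OF bij_is_inj[OF bij_reflection], of e Vm] unfolding reflect_Vm ..
    then show ?thesis by simp
  qed
  show ?thesis
  proof (intro subset_antisym subsetI)
    fix e assume "e \<in> (`) \<theta> ` Em"
    then show "e \<in> Ep" using edges_reflect 1 by (auto simp: Em_def Ep_def)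
  next
    fix e assume "e \<in> Ep"
    then have "\<theta> ` e \<in> Em" using edges_reflect 1[of "\<theta> ` e"] by (simp add: Em_def Ep_def)
    then show "e \<in> (`) \<theta> ` Em" by (metis image_involution imageI)
  qed
qed

text \<open>
  A fixed edge that contains a vertex of \<open>Vp\<close> also contains its mirror image in \<open>Vm\<close>; the converse
  is \<open>crossing_fixed\<close>.
\<close>

lemma reflect_fixed: "e \<in> Ep \<Longrightarrow> \<theta> ` e = e \<longleftrightarrow> e \<in> Em"
proof
  assume e: "e \<in> Ep" and "\<theta> ` e = e"
  obtain x where x: "x \<in> e" "x \<in> Vp" using e by (auto simp: Ep_def)
  then have "\<theta> x \<in> e" "\<theta> x \<in> Vm"
    using \<open>\<theta> ` e = e\<close> half_reflect by (auto simp: Vm_def)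
  then show "e \<in> Em" using e by (auto simp: Em_def Ep_def)
next
  assume "e \<in> Ep" "e \<in> Em"
  then obtain x y where "e \<in> E" "x \<in> e" "x \<in> Vp" "y \<in> e" "y \<notin> Vp"
    unfolding Em_def Ep_def Vm_def by blast
  then show "\<theta> ` e = e" by (rule crossing_fixed)
qed

lemma incident_Ep: "e \<in> E \<Longrightarrow> x \<in> Vp \<Longrightarrow> x \<in> e \<Longrightarrow> e \<in> Ep"
  and incident_Em: "e \<in> E \<Longrightarrow> x \<in> Vm \<Longrightarrow> x \<in> e \<Longrightarrow> e \<in> Em"
  by (auto simp: Ep_def Em_def)

text \<open>
  Folding along the mirror turns a configuration into two configurations on the same half graph.
\<close>

definition fold_halves :: "'v wire \<Rightarrow> 'v wire \<times> 'v wire" where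
  "fold_halves w = (cut_wire Vp Ep w, relabel \<theta> Vm (cut_wire Vm Em w))"

lemma cut_halves_wires:
  assumes "w \<in> wires V E N"
  shows "cut_wire Vp Ep w \<in> wires Vp Ep N" and "cut_wire Vm Em w \<in> wires Vm Em N"
  using assms half_subset by (auto intro!: cut_wires[of _ E _ V] simp: Ep_def Em_def Vm_def)

lemma trace_on_relabel:
  "trace_on (Ep \<inter> Em) (relabel \<theta> Vm w) = trace_on (Ep \<inter> Em) w"
proof -
  have "\<theta> ` e = e" if "e \<in> Ep \<inter> Em" for e
    using that reflect_fixed by blast
  then show ?thesis
    by (cases w) (auto simp: trace_on_def relabel_def vimage_reflection fun_eq_iff restrict_def)
qed

lemma bij_betw_fold_halves:
  "bij_betw fold_halves (wires V E N)
     {(w, w'). w \<in> wires Vp Ep N \<and> w' \<in> wires Vp Ep N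
        \<and> trace_on (Ep \<inter> Em) w = trace_on (Ep \<inter> Em) w'}" (is "bij_betw _ _ ?P")
proof -
  let ?Q = "{p \<in> wires Vp Ep N \<times> wires Vm Em N.
    trace_on (Ep \<inter> Em) (fst p) = trace_on (Ep \<inter> Em) (snd p)}"
  have "bij_betw (\<lambda>w. (cut_wire Vp Ep w, cut_wire Vm Em w)) (wires V E N)
    {(w1, w2) \<in> wires Vp Ep N \<times> wires Vm Em N. trace_on (Ep \<inter> Em) w1 = trace_on (Ep \<inter> Em) w2}"
    by (rule bij_betw_cut) (use half_subset E_eq incident_Ep incident_Em in \<open>auto simp: Vm_def\<close>)
  then have 1: "bij_betw (\<lambda>w. (cut_wire Vp Ep w, cut_wire Vm Em w)) (wires V E N) ?Q"
    by (simp add: case_prod_unfold mem_Times_iff conj_assoc)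
  have "bij_betw (relabel \<theta> Vm) (wires Vm Em N) (wires Vp Ep N)"
    using bij_betw_relabel[OF bij_reflection, of Vm Em N] unfolding reflect_Vm reflect_Em .
  then have "bij_betw (map_prod id (relabel \<theta> Vm)) (wires Vp Ep N \<times> wires Vm Em N)
      (wires Vp Ep N \<times> wires Vp Ep N)"
    by (intro bij_betw_map_prod) auto
  then have "bij_betw (map_prod id (relabel \<theta> Vm)) ?Q {p \<in> wires Vp Ep N \<times> wires Vp Ep N.
    trace_on (Ep \<inter> Em) (fst p) = trace_on (Ep \<inter> Em) (snd p)}"
    by (rule bij_betw_Collect) (simp add: trace_on_relabel)
  from bij_betw_trans[OF 1 this]
  have "bij_betw fold_halves (wires V E N) {p \<in> wires Vp Ep N \<times> wires Vp Ep N.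
    trace_on (Ep \<inter> Em) (fst p) = trace_on (Ep \<inter> Em) (snd p)}"
    by (simp add: o_def fold_halves_def[abs_def])
  also have "{p \<in> wires Vp Ep N \<times> wires Vp Ep N.
    trace_on (Ep \<inter> Em) (fst p) = trace_on (Ep \<inter> Em) (snd p)} = ?P"
    by auto
  finally show ?thesis .
qed

text \<open>
  A crossing edge occurs in both halves, so each half receives the square root of its weight.
\<close>

definition half_weight :: "nat \<Rightarrow> real \<Rightarrow> weight_fun \<Rightarrow> 'v wire \<Rightarrow> real" where
  "half_weight N \<beta> U w =
     (\<Prod>e\<in>Ep. let a = \<beta> ^ fst w e / fact (fst w e) in if \<theta> ` e = e then sqrt a else a)
     * (\<Prod>x\<in>Vp. vertex_weight Ep N U w x)"

lemma wire_weight_fold_halves: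
  assumes "\<beta> \<ge> 0"
  shows "wire_weight V E N \<beta> U w
    = half_weight N \<beta> U (fst (fold_halves w)) * half_weight N \<beta> U (snd (fold_halves w))"
proof -
  define a where "a e = \<beta> ^ fst w e / fact (fst w e)" for e
  let ?w' = "relabel \<theta> Vm (cut_wire Vm Em w)"
  have fin: "finite Ep" "finite Em" using finite_E by (simp_all add: Ep_def Em_def)
  have inj: "inj \<theta>" using bij_reflection by (rule bij_is_inj)
  have injE: "inj_on ((`) \<theta>) Em" and injV: "inj_on \<theta> Vm"
    by (simp_all add: inj_on_def inj_image_eq_iff[OF inj] inj_eq[OF inj])
  have vp: "vertex_weight Ep N U (cut_wire Vp Ep w) x = vertex_weight E N U w x" if "x \<in> Vp" for x
    using that E_eq incident_Ep by (intro cut_vertex_weight) auto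
  have vm: "vertex_weight Ep N U ?w' (\<theta> x) = vertex_weight E N U w x" if "x \<in> Vm" for x
  proof -
    have "vertex_weight Ep N U ?w' (\<theta> x) = vertex_weight Em N U (cut_wire Vm Em w) x"
      using relabel_vertex_weight[OF bij_reflection that, of Em N U "cut_wire Vm Em w"]
      unfolding reflect_Em .
    also have "\<dots> = vertex_weight E N U w x"
      using that E_eq incident_Em by (intro cut_vertex_weight) auto
    finally show ?thesis .
  qed
  have split_E: "prod g Ep = prod g (Ep - Em) * prod g (Ep \<inter> Em)"
    "prod g Em = prod g (Em - Ep) * prod g (Ep \<inter> Em)"
    "prod g E = prod g (Ep - Em) * prod g (Em - Ep) * prod g (Ep \<inter> Em)" for g :: "'v set \<Rightarrow> real"
  proof -
    show p: "prod g Ep = prod g (Ep - Em) * prod g (Ep \<inter> Em)"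
      using fin by (subst prod.union_disjoint[symmetric]) (auto intro: prod.cong)
    show "prod g Em = prod g (Em - Ep) * prod g (Ep \<inter> Em)"
      using fin by (subst prod.union_disjoint[symmetric]) (auto intro: prod.cong)
    have "prod g E = prod g Ep * prod g (Em - Ep)"
      using fin E_eq by (subst prod.union_disjoint[symmetric]) (auto intro: prod.cong)
    then show "prod g E = prod g (Ep - Em) * prod g (Em - Ep) * prod g (Ep \<inter> Em)"
      using p by simp
  qed
  have e1: "(\<Prod>e\<in>Ep. let b = \<beta> ^ fst (cut_wire Vp Ep w) e / fact (fst (cut_wire Vp Ep w) e) in
      if \<theta> ` e = e then sqrt b else b) = prod a (Ep - Em) * (\<Prod>e\<in>Ep \<inter> Em. sqrt (a e))"
    unfolding split_E by (intro arg_cong2[where f = "(*)"] prod.cong)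
      (auto simp: fst_cut a_def reflect_fixed)
  have fm: "\<theta> ` e = e \<longleftrightarrow> e \<in> Ep" if "e \<in> Em" for e
    using reflect_fixed that reflect_Em by (metis image_eqI)
  have "(\<Prod>e\<in>Ep. let b = \<beta> ^ fst ?w' e / fact (fst ?w' e) in
      if \<theta> ` e = e then sqrt b else b) = (\<Prod>e\<in>Em. if \<theta> ` e = e then sqrt (a e) else a e)"
    by (subst reflect_Em[symmetric], subst prod.reindex[OF injE], unfold o_def, intro prod.cong)
      (auto simp: fst_relabel vimage_reflection fst_cut a_def Let_def)
  also have "\<dots> = prod a (Em - Ep) * (\<Prod>e\<in>Ep \<inter> Em. sqrt (a e))"
    unfolding split_E by (intro arg_cong2[where f = "(*)"] prod.cong) (auto simp: fm)
  finally have e2: "(\<Prod>e\<in>Ep. let b = \<beta> ^ fst ?w' e / fact (fst ?w' e) in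
      if \<theta> ` e = e then sqrt b else b) = prod a (Em - Ep) * (\<Prod>e\<in>Ep \<inter> Em. sqrt (a e))" .
  have "(\<Prod>e\<in>Ep \<inter> Em. sqrt (a e)) * (\<Prod>e\<in>Ep \<inter> Em. sqrt (a e)) = prod a (Ep \<inter> Em)"
    using assms by (simp add: prod.distrib[symmetric] a_def)
  moreover have "(\<Prod>x\<in>Vp. vertex_weight Ep N U ?w' x) = (\<Prod>x\<in>Vm. vertex_weight E N U w x)"
    using prod.reindex[OF injV, of "vertex_weight Ep N U ?w'"] vm
    by (simp add: reflect_Vm)
  moreover have "(\<Prod>x\<in>V. vertex_weight E N U w x)
      = (\<Prod>x\<in>Vp. vertex_weight E N U w x) * (\<Prod>x\<in>Vm. vertex_weight E N U w x)"
    using half_subset finite_V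
    by (subst prod.union_disjoint[symmetric]) (auto simp: Vm_def intro: prod.cong finite_subset)
  ultimately show ?thesis
    unfolding wire_weight_def half_weight_def fold_halves_def fst_conv snd_conv e1 e2
      a_def[symmetric] split_E(3) by (simp add: vp mult_ac)
qed

text \<open>
  The source condition at a vertex only involves the half that contains it, so it factorizes along
  the fold.
\<close>

lemma sources_fold_halves:
  assumes w: "w \<in> wires V E N" and x: "x \<in> Vp" and y: "y \<in> Vp"
  shows "w \<in> sources V E N {x, \<theta> y} \<longleftrightarrow>
    fst (fold_halves w) \<in> sources Vp Ep N {x} \<and> snd (fold_halves w) \<in> sources Vp Ep N {y}"
proof -
  have y': "\<theta> y \<in> Vm" using y half_reflect by (auto simp: Vm_def)
  have up: "unpaired Ep (cut_wire Vp Ep w) z 1 = unpaired E w z 1" if "z \<in> Vp" for z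
    using that E_eq incident_Ep by (intro cut_counts) auto
  have um: "unpaired Em (cut_wire Vm Em w) z 1 = unpaired E w z 1" if "z \<in> Vm" for z
    using that E_eq incident_Em by (intro cut_counts) auto
  have "relabel \<theta> Vm (cut_wire Vm Em w) \<in> sources Vp Ep N {y} \<longleftrightarrow> cut_wire Vm Em w \<in> sources Vm Em N {\<theta> y}"
    using relabel_sources[OF bij_reflection cut_halves_wires(2)[OF w], of "{\<theta> y}"] y'
    unfolding reflect_Vm reflect_Em by simp
  moreover have "cut_wire Vm Em w \<in> sources Vm Em N {\<theta> y} \<longleftrightarrow>
      unpaired E w (\<theta> y) 1 = 1 \<and> (\<forall>z\<in>Vm - {\<theta> y}. unpaired E w z 1 = 0)"
    using cut_halves_wires(2)[OF w] y' um by (simp add: sources_def)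
  moreover have "cut_wire Vp Ep w \<in> sources Vp Ep N {x} \<longleftrightarrow>
      unpaired E w x 1 = 1 \<and> (\<forall>z\<in>Vp - {x}. unpaired E w z 1 = 0)"
    using cut_halves_wires(1)[OF w] x up by (simp add: sources_def)
  moreover have "V - {x, \<theta> y} = (Vp - {x}) \<union> (Vm - {\<theta> y})"
    using x y' half_subset by (auto simp: Vm_def)
  ultimately show ?thesis
    using w unfolding sources_def[of V] fold_halves_def by auto
qed

text \<open>
  After folding, the double sum becomes a sum of \<open>a w * a w'\<close> over pairs of half configurations
  with the same trace, where \<open>a w\<close> is the half weight of \<open>w\<close> times the value of \<open>f\<close> at the only
  source of \<open>w\<close>, and zero if there is no such source. Such a sum is a sum of squares.
\<close>

theorem reflection_positive:
  assumes "\<beta> \<ge> 0" and fm: "finite_mass V E N \<beta> U"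
  shows "(\<Sum>x\<in>Vp. \<Sum>y\<in>Vp. f x * f y * wire_measure V E N \<beta> U (sources V E N {x, \<theta> y})) \<ge> 0"
proof -
  define P where "P = {(w, w'). w \<in> wires Vp Ep N \<and> w' \<in> wires Vp Ep N
        \<and> trace_on (Ep \<inter> Em) w = trace_on (Ep \<inter> Em) w'}"
  define a where "a w = half_weight N \<beta> U w * (\<Sum>x\<in>Vp. f x * of_bool (w \<in> sources Vp Ep N {x}))" for w
  let ?S = "\<lambda>w. \<Sum>x\<in>Vp. \<Sum>y\<in>Vp. f x * f y * (wire_weight V E N \<beta> U w * of_bool (w \<in> sources V E N {x, \<theta> y}))"
  have single: "((\<lambda>w. wire_weight V E N \<beta> U w * of_bool (w \<in> sources V E N A))
      has_sum wire_measure V E N \<beta> U (sources V E N A)) (wires V E N)" for A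
  proof -
    have sub: "sources V E N A \<subseteq> wires V E N" by (auto simp: sources_def)
    have "(wire_weight V E N \<beta> U has_sum wire_measure V E N \<beta> U (sources V E N A)) (sources V E N A)"
      unfolding wire_measure_def
      by (rule has_sum_infsum, rule summable_on_subset_banach[OF _ sub])
        (use fm in \<open>simp add: finite_mass_def\<close>)
    also have "?this \<longleftrightarrow> ?thesis"
      by (rule has_sum_cong_neutral) (use sub in auto)
    finally show ?thesis .
  qed
  have sum: "(?S has_sum (\<Sum>x\<in>Vp. \<Sum>y\<in>Vp. f x * f y * wire_measure V E N \<beta> U (sources V E N {x, \<theta> y})))
      (wires V E N)"
    by (intro has_sum_finite_sum has_sum_cmult_right single)
  have eq: "?S w = (case fold_halves w of (w, w') \<Rightarrow> a w * a w')" if w: "w \<in> wires V E N" for w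
  proof -
    obtain w1 w2 where f: "fold_halves w = (w1, w2)" by (cases "fold_halves w")
    have "wire_weight V E N \<beta> U w = half_weight N \<beta> U w1 * half_weight N \<beta> U w2"
      using wire_weight_fold_halves[OF assms(1), of N U w] f by simp
    moreover have "of_bool (w \<in> sources V E N {x, \<theta> y})
        = of_bool (w1 \<in> sources Vp Ep N {x}) * (of_bool (w2 \<in> sources Vp Ep N {y}) :: real)"
      if "x \<in> Vp" "y \<in> Vp" for x y
      using sources_fold_halves[OF w that] f by simp
    ultimately have "?S w = (\<Sum>x\<in>Vp. \<Sum>y\<in>Vp.
       (half_weight N \<beta> U w1 * (f x * of_bool (w1 \<in> sources Vp Ep N {x}))) *
       (half_weight N \<beta> U w2 * (f y * of_bool (w2 \<in> sources Vp Ep N {y}))))"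
      by (intro sum.cong refl) (simp add: mult_ac)
    also have "\<dots> = a w1 * a w2"
      unfolding a_def sum_distrib_left[of "half_weight N \<beta> U _"] sum_product ..
    finally show ?thesis using f by simp
  qed
  have bij: "bij_betw fold_halves (wires V E N) P"
    unfolding P_def by (rule bij_betw_fold_halves)
  have "((\<lambda>w. case fold_halves w of (w, w') \<Rightarrow> a w * a w') has_sum
      (\<Sum>x\<in>Vp. \<Sum>y\<in>Vp. f x * f y * wire_measure V E N \<beta> U (sources V E N {x, \<theta> y}))) (wires V E N)"
    using sum by (rule has_sum_cong[THEN iffD1, rotated]) (rule eq)
  then have sum': "((\<lambda>(w, w'). a w * a w') has_sum
      (\<Sum>x\<in>Vp. \<Sum>y\<in>Vp. f x * f y * wire_measure V E N \<beta> U (sources V E N {x, \<theta> y}))) P"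
    by (subst (asm) has_sum_reindex_bij_betw[OF bij])
  then have "infsum (\<lambda>(w, w'). a w * a w') P \<ge> 0"
    unfolding P_def by (intro infsum_fibre_pairs_nonneg) (auto simp: summable_on_def)
  then show ?thesis using infsumI[OF sum'] by simp
qed

end

section \<open>Convex sequences\<close>

text \<open>
  Symmetry reverses the sign of the increments: the increment at \<open>k\<close> is minus the increment at
  \<open>h - 2 - k\<close>. By convexity the increments grow, so those left of the centre are not positive.
\<close>

lemma convex_symmetric_antimono:
  fixes a :: "nat \<Rightarrow> real"
  assumes convex: "\<And>k. k + 2 < h \<Longrightarrow> 2 * a (k + 1) \<le> a k + a (k + 2)"
    and sym: "\<And>k. k < h \<Longrightarrow> a (h - 1 - k) = a k"
    and "j \<le> k" "2 * k < h"
  shows "a k \<le> a j"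
proof -
  have incr: "a (k + 1) - a k \<le> a (k + d + 1) - a (k + d)" if "k + d + 1 < h" for k d
    using that
  proof (induction d)
    case (Suc d)
    then show ?case using convex[of "k + d"] by simp
  qed simp
  have step: "a (k + 1) \<le> a k" if "2 * (k + 1) < h" for k
  proof -
    \<comment> \<open>chosen such that \<open>k + d\<close> is the mirror image \<open>h - 2 - k\<close> of the increment at \<open>k\<close>\<close>
    define d where "d = h - 2 - 2 * k"
    have "k + d + 1 = h - 1 - k" "k + d = h - 1 - (k + 1)" "k + d + 1 < h"
      using that by (auto simp: d_def)
    then show ?thesis using incr[of k d] sym[of k] sym[of "k + 1"] that by simp
  qed
  show ?thesis using \<open>j \<le> k\<close> \<open>2 * k < h\<close>
  proof (induction k rule: dec_induct)
    case (step n)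
    then show ?case using \<open>\<And>k. 2 * (k + 1) < h \<Longrightarrow> a (k + 1) \<le> a k\<close>[of n] by simp
  qed simp
qed

section \<open>Symmetries of the torus\<close>

definition flip :: "'d \<Rightarrow> int ^ 'd \<Rightarrow> int ^ 'd" where
  "flip i x = (\<chi> j. if j = i then - x $ j else x $ j)"

text \<open>
  One family of automorphisms suffices: it contains the reflections in the hyperplanes orthogonal
  to direction \<open>i\<close>, combined with all translations, and it is closed under inverses. Outside the
  torus the map is the identity, so that it is a bijection of the whole type, as
  \<open>wire_measure_relabel\<close> needs.
\<close>

definition flip_shift :: "nat \<Rightarrow> 'd \<Rightarrow> int ^ 'd \<Rightarrow> int ^ 'd \<Rightarrow> int ^ 'd" where
  "flip_shift L i v x = (if x \<in> torus L then wrap L (flip i x + v) else x)"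

lemma flip_nth: "flip i x $ j = (if j = i then - x $ j else x $ j)"
  by (simp add: flip_def)

lemma flip_simps [simp]:
  "flip i (flip i x) = x" "flip i 0 = 0" "flip i (x + y) = flip i x + flip i y"
  "flip i (x - y) = flip i x - flip i y" "flip i (- x) = - flip i x"
  by (simp_all add: vec_eq_iff flip_nth)

lemma scaled_axis_nth: "(n *s axis i 1 :: int ^ 'd) $ j = (if j = i then n else 0)"
  by (simp add: axis_def)

lemma flip_axis: "flip i (axis j 1) = (if j = i then - axis i 1 else axis j 1)"
  by (auto simp: vec_eq_iff flip_nth axis_def)

lemma wrap_in_torus: "L > 0 \<Longrightarrow> wrap L x \<in> torus L"
  by (simp add: torus_def wrap_def)

lemma wrap_idem: "x \<in> torus L \<Longrightarrow> wrap L x = x"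
  by (simp add: torus_def wrap_def vec_eq_iff)

lemma wrap_wrap_add: "wrap L (wrap L x + y) = wrap L (x + y)"
  by (simp add: wrap_def vec_eq_iff mod_add_left_eq)

lemma wrap_flip_wrap: "wrap L (flip i (wrap L x) + y) = wrap L (flip i x + y)"
proof -
  have "(- (a mod n) + b) mod n = (- a + b) mod n" for a b n :: int
    using mod_diff_right_eq[of b a n] by simp
  then show ?thesis by (simp add: wrap_def vec_eq_iff flip_nth mod_add_left_eq)
qed

lemma zero_in_torus: "L > 0 \<Longrightarrow> 0 \<in> torus L"
  by (simp add: torus_def)

lemma flip_shift_wrap: "L > 0 \<Longrightarrow> flip_shift L i v (wrap L x) = wrap L (flip i x + v)"
  by (simp add: flip_shift_def wrap_in_torus wrap_flip_wrap)

lemma wrap_zero: "wrap L 0 = 0"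
  by (simp add: wrap_def vec_eq_iff)

lemma flip_shift_zero: "L > 0 \<Longrightarrow> flip_shift L i v 0 = wrap L v"
  by (simp add: flip_shift_def zero_in_torus)

lemma flip_shift_inverse:
  assumes "L > 0"
  shows "flip_shift L i (- flip i v) (flip_shift L i v x) = x"
proof (cases "x \<in> torus L")
  case True
  then show ?thesis
    using assms by (simp add: flip_shift_def[of L i v] flip_shift_wrap wrap_idem)
qed (simp add: flip_shift_def)

lemma flip_shift_inverse':
  assumes "L > 0"
  shows "flip_shift L i v (flip_shift L i (- flip i v) x) = x"
  using flip_shift_inverse[OF assms, of i "- flip i v" x] by simp

lemma bij_flip_shift: "L > 0 \<Longrightarrow> bij (flip_shift L i v)"
  by (rule o_bij[of "flip_shift L i (- flip i v)"])
    (simp_all add: fun_eq_iff flip_shift_inverse flip_shift_inverse')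

lemma flip_shift_in_torus: "L > 0 \<Longrightarrow> x \<in> torus L \<Longrightarrow> flip_shift L i v x \<in> torus L"
  by (simp add: flip_shift_def wrap_in_torus)

lemma flip_shift_torus:
  fixes v :: "int ^ 'd"
  assumes "L > 0"
  shows "flip_shift L i v ` torus L = torus L"
proof (intro subset_antisym subsetI)
  fix x :: "int ^ 'd" assume "x \<in> torus L"
  then show "x \<in> flip_shift L i v ` torus L"
    using flip_shift_inverse'[OF assms, of i v x] flip_shift_in_torus[OF assms] by (metis imageI)
qed (use flip_shift_in_torus[OF assms] in auto)

lemma flip_shift_edge:
  fixes v :: "int ^ 'd::finite"
  assumes "L > 0" and "e \<in> torus_edges L"
  shows "flip_shift L i v ` e \<in> torus_edges L"
proof -
  obtain x j where e: "e = {x, wrap L (x + axis j 1)}" and x: "x \<in> torus L"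
    using assms(2) by (auto simp: torus_edges_def)
  let ?y = "wrap L (flip i x + v)"
  have img: "flip_shift L i v ` e = {?y, wrap L (flip i (x + axis j 1) + v)}"
    using x assms(1) by (simp add: e flip_shift_wrap) (simp add: flip_shift_def)
  show ?thesis
  proof (cases "j = i")
    case True
    \<comment> \<open>the flip reverses edges in direction \<open>i\<close>, so the image starts at the image of the other end\<close>
    let ?z = "wrap L (flip i (x + axis j 1) + v)"
    have "wrap L (?z + axis i 1) = ?y"
      unfolding wrap_wrap_add using True by (simp add: flip_axis)
    then have "flip_shift L i v ` e = {?z, wrap L (?z + axis i 1)}" unfolding img by auto
    then show ?thesis using wrap_in_torus[OF assms(1)] unfolding torus_edges_def by blast
  next
    case False
    have "wrap L (flip i (x + axis j 1) + v) = wrap L (?y + axis j 1)"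
      unfolding wrap_wrap_add using False by (simp add: flip_axis algebra_simps)
    then have "flip_shift L i v ` e = {?y, wrap L (?y + axis j 1)}" unfolding img by simp
    then show ?thesis using wrap_in_torus[OF assms(1)] unfolding torus_edges_def by blast
  qed
qed

lemma flip_shift_edges:
  fixes v :: "int ^ 'd::finite"
  assumes "L > 0"
  shows "(`) (flip_shift L i v) ` torus_edges L = torus_edges L"
proof (intro subset_antisym subsetI)
  fix e :: "(int ^ 'd) set" assume "e \<in> torus_edges L"
  then have "flip_shift L i (- flip i v) ` e \<in> torus_edges L" by (rule flip_shift_edge[OF assms])
  moreover have "flip_shift L i v ` flip_shift L i (- flip i v) ` e = e"
    by (simp add: image_image flip_shift_inverse'[OF assms])
  ultimately show "e \<in> (`) (flip_shift L i v) ` torus_edges L" by (metis imageI)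
qed (use flip_shift_edge[OF assms] in auto)

text \<open>
  The unnormalized two-point function at displacement \<open>u\<close>; wrapping allows displacements to be
  computed in the integer lattice.
\<close>

definition pair_mass :: "nat \<Rightarrow> nat \<Rightarrow> real \<Rightarrow> weight_fun \<Rightarrow> int ^ 'd \<Rightarrow> real" where
  "pair_mass L N \<beta> U u =
     wire_measure (torus L) (torus_edges L) N \<beta> U (sources (torus L) (torus_edges L) N {0, wrap L u})"

lemma flip_shift_mass:
  fixes A :: "(int ^ 'd::finite) set"
  assumes "L > 0" and "A \<subseteq> torus L"
  shows "wire_measure (torus L) (torus_edges L) N \<beta> U
      (sources (torus L) (torus_edges L) N (flip_shift L i v ` A))
    = wire_measure (torus L) (torus_edges L) N \<beta> U (sources (torus L) (torus_edges L) N A)"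
  using wire_measure_relabel[OF bij_flip_shift[OF assms(1)] assms(2), of i v "torus_edges L" N \<beta> U]
  by (simp add: flip_shift_torus[OF assms(1)] flip_shift_edges[OF assms(1)])

lemma pair_mass_flip:
  assumes "L > 0"
  shows "pair_mass L N \<beta> U (flip i u) = pair_mass L N \<beta> U (u :: int ^ 'd::finite)"
proof -
  have "flip_shift L i 0 ` {0, wrap L u} = {0, wrap L (flip i u)}"
    by (simp add: flip_shift_wrap[OF assms] flip_shift_zero[OF assms] wrap_zero)
  moreover have "{0, wrap L u} \<subseteq> torus L"
    using wrap_in_torus[OF assms] zero_in_torus[OF assms] by blast
  ultimately show ?thesis unfolding pair_mass_def
    using flip_shift_mass[OF assms, of "{0, wrap L u}" N \<beta> U i 0] by simp
qed

lemma pair_mass_neg_flip: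
  assumes "L > 0"
  shows "pair_mass L N \<beta> U (- flip i u) = pair_mass L N \<beta> U (u :: int ^ 'd::finite)"
proof -
  have "flip_shift L i (- flip i u) ` {0, wrap L u} = {0, wrap L (- flip i u)}"
    by (simp add: flip_shift_wrap[OF assms] flip_shift_zero[OF assms] wrap_zero insert_commute)
  moreover have "{0, wrap L u} \<subseteq> torus L"
    using wrap_in_torus[OF assms] zero_in_torus[OF assms] by blast
  ultimately show ?thesis unfolding pair_mass_def
    using flip_shift_mass[OF assms, of "{0, wrap L u}" N \<beta> U i "- flip i u"] by simp
qed

section \<open>The reflection between the two half-tori\<close>

text \<open>
  The mirror is \<open>x\<^sub>i \<mapsto> L - 1 - x\<^sub>i\<close>. Its hyperplanes lie between the coordinates \<open>L/2 - 1\<close> and \<open>L/2\<close>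
  and between \<open>L - 1\<close> and \<open>0\<close>; translation invariance makes this one reflection per direction
  enough.
\<close>

definition half_torus :: "nat \<Rightarrow> 'd \<Rightarrow> (int ^ 'd) set" where
  "half_torus L i = {x \<in> torus L. 2 * x $ i < int L}"

definition mirror :: "nat \<Rightarrow> 'd \<Rightarrow> int ^ 'd \<Rightarrow> int ^ 'd" where
  "mirror L i = flip_shift L i (- axis i 1)"

lemma mirror_nth:
  assumes "x \<in> torus L"
  shows "mirror L i x $ j = (if j = i then int L - 1 - x $ j else x $ j)"
proof -
  have b: "0 \<le> x $ j" "x $ j < int L" for j using assms by (auto simp: torus_def)
  have "(- x $ i - 1) mod int L = (int L - 1 - x $ i) mod int L"
    by (metis (no_types, opaque_lifting) add_diff_cancel_left' diff_add_eq diff_minus_eq_add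
        minus_mod_self1 mod_add_self1 uminus_add_conv_diff)
  also have "\<dots> = int L - 1 - x $ i" using b[of i] by (intro mod_pos_pos_trivial) auto
  finally show ?thesis
    using assms b[of j] by (auto simp: mirror_def flip_shift_def wrap_def flip_nth axis_def)
qed

lemma mirror_involution: "L > 0 \<Longrightarrow> mirror L i (mirror L i x) = x"
  using flip_shift_inverse[of L i "- axis i 1" x] by (simp add: mirror_def flip_axis)

lemma mirror_in_torus: "L > 0 \<Longrightarrow> x \<in> torus L \<Longrightarrow> mirror L i x \<in> torus L"
  by (simp add: mirror_def flip_shift_in_torus)

lemma mirror_half_iff:
  assumes "even L" "L > 0" "x \<in> torus L"
  shows "mirror L i x \<in> half_torus L i \<longleftrightarrow> x \<notin> half_torus L i"
  using assms mirror_in_torus[OF assms(2,3), of i]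
  by (auto simp: half_torus_def mirror_nth elim!: evenE)

text \<open>
  Only a step in direction \<open>i\<close> changes the half, and only from \<open>L/2 - 1\<close> to \<open>L/2\<close> or from \<open>L - 1\<close> to
  \<open>0\<close>; in both cases the two coordinates are mirror images of each other.
\<close>

lemma crossing_step:
  assumes "even L" "L > 0" and x: "x \<in> torus L"
    and cross: "x \<in> half_torus L i \<longleftrightarrow> wrap L (x + axis j 1) \<notin> half_torus L i"
  shows "mirror L i x = wrap L (x + axis j 1)"
proof -
  let ?y = "wrap L (x + axis j 1)"
  have b: "0 \<le> x $ k" "x $ k < int L" for k using x by (auto simp: torus_def)
  have y: "?y \<in> torus L" using assms by (simp add: wrap_in_torus)
  have yk: "?y $ k = (if k = j then (x $ k + 1) mod int L else x $ k)" for k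
    using b[of k] by (simp add: wrap_def axis_def)
  have "j = i"
    using cross x y yk[of i] by (auto simp: half_torus_def split: if_splits)
  obtain h where L: "L = 2 * h" using assms(1) by (elim evenE)
  have c: "2 * x $ i < int L \<longleftrightarrow> \<not> 2 * ((x $ i + 1) mod int L) < int L"
    using cross x y yk[of i] \<open>j = i\<close> by (simp add: half_torus_def)
  have "(x $ i + 1) mod int L = int L - 1 - x $ i"
  proof (cases "x $ i + 1 = int L")
    case False
    then have "(x $ i + 1) mod int L = x $ i + 1" using b[of i] by (intro mod_pos_pos_trivial) auto
    then show ?thesis using c b[of i] L by auto
  qed (use c b[of i] in auto)
  then show ?thesis
    using yk \<open>j = i\<close> by (simp add: vec_eq_iff mirror_nth[OF x])
qed

lemma reflected_torus:
  assumes "even L" "L > 0"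
  shows "reflected_graph (torus L) (torus_edges L) (mirror L i) (half_torus L (i :: 'd::finite))"
proof
  have L2: "L \<ge> 2" using assms by (auto elim!: evenE)
  show "finite (torus L :: (int ^ 'd) set)" by (rule finite_torus)
  have "torus_edges L \<subseteq> Pow (torus L :: (int ^ 'd) set)"
    using torus_edges_simple(1)[OF L2] by blast
  then show "finite (torus_edges L :: (int ^ 'd) set set)"
    by (rule finite_subset) (simp add: finite_torus)
  show "e \<noteq> {}" if "e \<in> torus_edges L" for e :: "(int ^ 'd) set"
    using that by (auto simp: torus_edges_def)
  show "e \<subseteq> torus L" if "e \<in> torus_edges L" for e :: "(int ^ 'd) set"
    using torus_edges_simple(1)[OF L2 that] .
  show "mirror L i (mirror L i x) = x" for x
    using assms by (simp add: mirror_involution)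
  show "mirror L i ` e \<in> torus_edges L" if "e \<in> torus_edges L" for e
    using flip_shift_edge[OF assms(2) that] by (simp add: mirror_def)
  show half: "half_torus L i \<subseteq> torus L" by (auto simp: half_torus_def)
  show "mirror L i ` half_torus L i = torus L - half_torus L i"
  proof (intro subset_antisym subsetI)
    fix x assume "x \<in> torus L - half_torus L i"
    then have "mirror L i x \<in> half_torus L i" using mirror_half_iff[OF assms] by blast
    then show "x \<in> mirror L i ` half_torus L i"
      using mirror_involution[OF assms(2)] by (metis imageI)
  next
    fix x assume "x \<in> mirror L i ` half_torus L i"
    then obtain y where y: "y \<in> half_torus L i" "x = mirror L i y" by blast
    then show "x \<in> torus L - half_torus L i"
      using half mirror_half_iff[OF assms, of y i] mirror_in_torus[OF assms(2), of y i] by blast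
  qed
  fix e and x y :: "int ^ 'd"
  assume e: "e \<in> torus_edges L" and xy: "x \<in> e" "x \<in> half_torus L i" "y \<in> e" "y \<notin> half_torus L i"
  obtain z j where z: "e = {z, wrap L (z + axis j 1)}" "z \<in> torus L"
    using e by (auto simp: torus_edges_def)
  then have "mirror L i z = wrap L (z + axis j 1)"
    using crossing_step[OF assms z(2), of i j] xy by auto
  then show "mirror L i ` e = e"
    using mirror_involution[OF assms(2), of i z] by (auto simp: z(1))
qed

text \<open>
  The automorphism that flips direction \<open>i\<close> and moves \<open>x\<close> to the origin takes \<open>mirror L i y\<close> to the
  stated displacement, whose \<open>i\<close>-th coordinate is \<open>x $ i + y $ i + 1\<close>.
\<close>

lemma mirror_pair_mass:
  assumes "L > 0" and x: "x \<in> half_torus L i" and y: "y \<in> half_torus L i"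
  shows "wire_measure (torus L) (torus_edges L) N \<beta> U
      (sources (torus L) (torus_edges L) N {x, mirror L i y})
    = pair_mass L N \<beta> U (y - x + (2 * x $ i + 1) *s axis (i :: 'd::finite) 1)"
proof -
  have xt: "x \<in> torus L" and yt: "y \<in> torus L" using x y by (auto simp: half_torus_def)
  have my: "mirror L i y = wrap L (flip i y - axis i 1)"
    using yt by (simp add: mirror_def flip_shift_def)
  have "flip_shift L i (- flip i x) x = 0"
    using xt by (simp add: flip_shift_def wrap_zero)
  moreover have "flip i (flip i y - axis i 1) + - flip i x = y - x + (2 * x $ i + 1) *s axis i 1"
    by (simp add: vec_eq_iff flip_nth axis_def)
  then have "flip_shift L i (- flip i x) (mirror L i y) = wrap L (y - x + (2 * x $ i + 1) *s axis i 1)"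
    by (simp only: my flip_shift_wrap[OF assms(1)])
  moreover have "{x, mirror L i y} \<subseteq> torus L"
    using xt mirror_in_torus[OF assms(1) yt] by blast
  ultimately show ?thesis
    using flip_shift_mass[OF assms(1), of "{x, mirror L i y}" N \<beta> U i "- flip i x"]
    by (simp add: pair_mass_def)
qed

text \<open>
  Reflection positivity for the test function \<open>\<delta>\<^sub>p + \<delta>\<^sub>q - \<delta>\<^sub>r - \<delta>\<^sub>s\<close>; the points may coincide.
\<close>

lemma four_point_inequality:
  fixes p q r s :: "int ^ 'd::finite"
  assumes L: "even L" "L > 0" and \<beta>: "\<beta> \<ge> 0"
    and fm: "finite_mass (torus L :: (int ^ 'd) set) (torus_edges L) N \<beta> U"
    and mem: "p \<in> half_torus L i" "q \<in> half_torus L i" "r \<in> half_torus L i" "s \<in> half_torus L i"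
  defines "K \<equiv> \<lambda>x y. pair_mass L N \<beta> U (y - x + (2 * x $ i + 1) *s axis i 1)"
  shows "K p r + K p s + K q r + K q s + K r p + K r q + K s p + K s q
    \<le> K p p + K p q + K q p + K q q + K r r + K r s + K s r + K s s"
proof -
  interpret reflected_graph "torus L" "torus_edges L" "mirror L i" "half_torus L i"
    using L by (rule reflected_torus)
  define f :: "int ^ 'd \<Rightarrow> real" where
    "f x = of_bool (x = p) + of_bool (x = q) - of_bool (x = r) - of_bool (x = s)" for x
  have fin: "finite (half_torus L i)" using finite_V half_subset by (rule finite_subset[rotated])
  have single: "(\<Sum>x\<in>half_torus L i. of_bool (x = p) * g x) = g p"
    if "p \<in> half_torus L i" for p and g :: "int ^ 'd \<Rightarrow> real"
  proof -
    have "(\<Sum>x\<in>half_torus L i. of_bool (x = p) * g x) = (\<Sum>x\<in>half_torus L i. if x = p then g x else 0)"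
      by (intro sum.cong) auto
    then show ?thesis using that fin by simp
  qed
  have pick: "(\<Sum>x\<in>half_torus L i. f x * g x) = g p + g q - g r - g s" for g
    unfolding f_def left_diff_distrib distrib_right sum.distrib sum_subtractf
    by (simp only: single mem)
  have "0 \<le> (\<Sum>x\<in>half_torus L i. \<Sum>y\<in>half_torus L i. f x * f y * wire_measure (torus L) (torus_edges L) N \<beta> U
      (sources (torus L) (torus_edges L) N {x, mirror L i y}))"
    using \<beta> fm by (rule reflection_positive)
  also have "\<dots> = (\<Sum>x\<in>half_torus L i. f x * (\<Sum>y\<in>half_torus L i. f y * K x y))"
    by (simp add: mirror_pair_mass[OF L(2)] K_def sum_distrib_left mult.assoc)
  finally show ?thesis unfolding pick by simp
qed

lemma axis_point_half:
  assumes "y \<in> torus L" "y $ i = 0" "0 \<le> a" "2 * a < int L"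
  shows "y + a *s axis i 1 \<in> half_torus L i"
  using assms by (auto simp: half_torus_def torus_def scaled_axis_nth simp del: vector_smult_component)

text \<open>
  The first inequality comes from one point at height \<open>a\<close> on the axis and one at height \<open>b\<close> above
  \<open>y\<close>, each counted twice; the second from the four points at heights \<open>a\<close> and \<open>b\<close> above \<open>0\<close> and \<open>y\<close>.
\<close>

lemma pair_mass_midpoint:
  fixes y :: "int ^ 'd::finite"
  assumes L: "even L" "L > 0" and \<beta>: "\<beta> \<ge> 0"
    and fm: "finite_mass (torus L :: (int ^ 'd) set) (torus_edges L) N \<beta> U"
    and y: "y \<in> torus L" "y $ i = 0" and a: "0 \<le> a" "2 * a < int L" and b: "0 \<le> b" "2 * b < int L"
  shows "2 * pair_mass L N \<beta> U (y + (a + b + 1) *s axis i 1)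
    \<le> pair_mass L N \<beta> U ((2 * a + 1) *s axis i 1) + pair_mass L N \<beta> U ((2 * b + 1) *s axis i 1)"
    and "2 * (pair_mass L N \<beta> U (y + (a + b + 1) *s axis i 1)
        + pair_mass L N \<beta> U ((a + b + 1) *s axis i 1))
    \<le> (pair_mass L N \<beta> U (y + (2 * a + 1) *s axis i 1) + pair_mass L N \<beta> U ((2 * a + 1) *s axis i 1))
      + (pair_mass L N \<beta> U (y + (2 * b + 1) *s axis i 1) + pair_mass L N \<beta> U ((2 * b + 1) *s axis i 1))"
proof -
  let ?G = "pair_mass L N \<beta> U :: int ^ 'd \<Rightarrow> real"
  let ?e = "\<lambda>n. n *s axis i 1 :: int ^ 'd"
  \<comment> \<open>the displacements that go from above \<open>y\<close> to the axis have the opposite sign of \<open>y\<close>\<close>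
  have neg: "?G (- y + ?e n) = ?G (y + ?e n)" for n
  proof -
    have "- flip i (y + ?e n) = - y + ?e n"
      using y(2) by (simp add: vec_eq_iff flip_nth axis_def)
    then show ?thesis using pair_mass_neg_flip[OF L(2), of N \<beta> U i "y + ?e n"] by simp
  qed
  have pt: "?e c \<in> half_torus L i" "y + ?e c \<in> half_torus L i" if "0 \<le> c" "2 * c < int L" for c
    using axis_point_half[OF zero_in_torus[OF L(2)] _ that, of i] axis_point_half[OF y that] by simp_all
  have d: "?e c' - ?e c + ?e (2 * c + 1) = ?e (c + c' + 1)"
    "(y + ?e c') - ?e c + ?e (2 * c + 1) = y + ?e (c + c' + 1)"
    "?e c' - (y + ?e c) + ?e (2 * c + 1) = - y + ?e (c + c' + 1)"
    "(y + ?e c') - (y + ?e c) + ?e (2 * c + 1) = ?e (c + c' + 1)" for c c'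
    by (simp_all add: vec_eq_iff axis_def)
  have i: "?e c $ i = c" "(y + ?e c) $ i = c" for c using y(2) by simp_all
  have ee: "a + a + 1 = 2 * a + 1" "b + b + 1 = 2 * b + 1" "b + a + 1 = a + b + 1" by simp_all
  have arith: "2 * (B + A) \<le> (D + C) + (D' + C')"
    if "A + B + B + A + A + B + B + A \<le> C + D + D + C + C' + D' + D' + C'" for A B C D C' D' :: real
    using that by simp
  note four = four_point_inequality[OF L \<beta> fm]
  show "2 * ?G (y + ?e (a + b + 1)) \<le> ?G (?e (2 * a + 1)) + ?G (?e (2 * b + 1))"
    using four[OF pt(1)[OF a] pt(1)[OF a] pt(2)[OF b] pt(2)[OF b]]
    unfolding i d neg ee by linarith
  show "2 * (?G (y + ?e (a + b + 1)) + ?G (?e (a + b + 1)))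
    \<le> (?G (y + ?e (2 * a + 1)) + ?G (?e (2 * a + 1))) + (?G (y + ?e (2 * b + 1)) + ?G (?e (2 * b + 1)))"
    using four[OF pt(1)[OF a] pt(2)[OF a] pt(1)[OF b] pt(2)[OF b]]
    unfolding i d neg ee by (rule arith)
qed

section \<open>Monotonicity of the two-point function\<close>

lemma torus_two_point_eq:
  fixes z :: "int ^ 'd"
  assumes "z \<in> torus L" "z \<noteq> 0"
  shows "torus_two_point L N \<beta> U 0 z
    = pair_mass L N \<beta> U z / Z_set (torus L) (torus_edges L) N \<beta> U ({} :: (int ^ 'd) set)"
  using assms by (auto simp: two_point_def Z_pair_def Z_set_def[of _ _ _ _ _ "{0, z}"] pair_mass_def wrap_idem)

lemma partition_function_nonneg:
  assumes "\<beta> \<ge> 0" and "\<And>n u t. length n = N \<Longrightarrow> length u = N \<Longrightarrow> U n u t \<ge> 0"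
  shows "Z_set V E N \<beta> U {} \<ge> 0"
  using assms
  by (auto simp: Z_set_def wire_measure_def wire_weight_def vertex_weight_def
      intro!: infsum_nonneg mult_nonneg_nonneg prod_nonneg)

theorem theorem2p4:
  fixes i :: "'d::finite" and L N :: nat and \<beta> :: real and U :: weight_fun
  assumes "CARD('d) \<ge> 2"
    and "L > 0" and "even L"
    and "N > 0" and "\<beta> \<ge> 0"
    and "\<And>n u t. length n = N \<Longrightarrow> length u = N \<Longrightarrow> U n u t \<ge> 0"
    and "finite_mass (torus L :: (int ^ 'd) set) (torus_edges L) N \<beta> U"
  shows "(\<forall>z::int ^ 'd. z \<in> torus L \<longrightarrow>
            (odd (z $ i) \<longrightarrow>
               torus_two_point L N \<beta> U 0 z
                 \<le> torus_two_point L N \<beta> U 0 (z $ i *s axis i 1)) \<and>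
            (even (z $ i) \<and> z $ i \<noteq> 0 \<longrightarrow>
               torus_two_point L N \<beta> U 0 z
                 \<le> 1/2 * torus_two_point L N \<beta> U 0 ((z $ i - 1) *s axis i 1)
                 + 1/2 * torus_two_point L N \<beta> U 0 ((z $ i + 1) *s axis i 1)))
       \<and> (\<forall>y::int ^ 'd. y \<in> torus L \<and> y $ i = 0 \<longrightarrow>
            antimono_on {n::int. odd n \<and> 0 < n \<and> real_of_int n < real L / 2}
              (\<lambda>n. torus_two_point L N \<beta> U 0 (y + n *s axis i 1)
                 + torus_two_point L N \<beta> U 0 (n *s axis i 1)))"
proof -
  let ?G = "pair_mass L N \<beta> U :: int ^ 'd \<Rightarrow> real"
  let ?e = "\<lambda>n. n *s axis i 1 :: int ^ 'd"
  \<comment> \<open>the normalization is a nonnegative constant, so all inequalities reduce to \<open>pair_mass\<close>\<close>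
  define Z0 where "Z0 = Z_set (torus L) (torus_edges L) N \<beta> U ({} :: (int ^ 'd) set)"
  have Z0: "Z0 \<ge> 0" unfolding Z0_def by (rule partition_function_nonneg) (use assms in auto)
  have midpoint: "2 * ?G (y + ?e (a + b + 1)) \<le> ?G (?e (2 * a + 1)) + ?G (?e (2 * b + 1))"
      "2 * (?G (y + ?e (a + b + 1)) + ?G (?e (a + b + 1)))
        \<le> (?G (y + ?e (2 * a + 1)) + ?G (?e (2 * a + 1))) + (?G (y + ?e (2 * b + 1)) + ?G (?e (2 * b + 1)))"
    if "y \<in> torus L" "y $ i = 0" "0 \<le> a" "2 * a < int L" "0 \<le> b" "2 * b < int L" for y a b
    using pair_mass_midpoint[OF assms(3,2,5,7) that] by simp_all
  have G: "torus_two_point L N \<beta> U 0 (y + ?e n) = ?G (y + ?e n) / Z0"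
    if y: "y \<in> torus L" "y $ i = 0" and "0 < n" "n < int L" for y n
  proof -
    have "y + ?e n \<in> torus L" using that by (auto simp: torus_def axis_def)
    moreover have "(y + ?e n) $ i \<noteq> 0" using that by (simp add: axis_def)
    then have "y + ?e n \<noteq> 0" by (metis zero_index)
    ultimately show ?thesis unfolding Z0_def by (rule torus_two_point_eq)
  qed
  have G': "torus_two_point L N \<beta> U 0 (?e n) = ?G (?e n) / Z0" if "0 < n" "n < int L" for n
    using G[of 0 n] that zero_in_torus[OF assms(2)] by simp
  show ?thesis
  proof (intro conjI allI impI)
    fix z :: "int ^ 'd" assume z: "z \<in> torus L"
    define y where "y = z - ?e (z $ i)"
    have y: "y \<in> torus L" "y $ i = 0" and zy: "z = y + ?e (z $ i)"
      using z by (auto simp: torus_def y_def axis_def)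
    have bound: "0 \<le> z $ i" "z $ i < int L" using z by (auto simp: torus_def)
    {
      assume "odd (z $ i)"
      then obtain a where a: "z $ i = 2 * a + 1" by (elim oddE)
      have "?G (y + ?e (z $ i)) \<le> ?G (?e (z $ i))"
        using midpoint(1)[OF y, of a a] bound a by simp
      then show "torus_two_point L N \<beta> U 0 z \<le> torus_two_point L N \<beta> U 0 (?e (z $ i))"
        using G[OF y, of "z $ i"] G'[of "z $ i"] bound a Z0 zy by (simp add: divide_right_mono)
    next
      assume even: "even (z $ i) \<and> z $ i \<noteq> 0"
      then obtain b where b: "z $ i = 2 * b" by (elim conjE evenE)
      obtain h where h: "int L = 2 * h" using assms(3) by (metis even_of_nat evenE)
      have "2 * ?G (y + ?e (z $ i)) \<le> ?G (?e (z $ i - 1)) + ?G (?e (z $ i + 1))"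
        using midpoint(1)[OF y, of "b - 1" b] bound even b by simp
      then have "2 * ?G (y + ?e (z $ i)) / Z0 \<le> (?G (?e (z $ i - 1)) + ?G (?e (z $ i + 1))) / Z0"
        using Z0 by (rule divide_right_mono)
      then show "torus_two_point L N \<beta> U 0 z
          \<le> 1/2 * torus_two_point L N \<beta> U 0 (?e (z $ i - 1))
          + 1/2 * torus_two_point L N \<beta> U 0 (?e (z $ i + 1))"
        using G[OF y, of "z $ i"] G'[of "z $ i - 1"] G'[of "z $ i + 1"] bound even b h zy
        by (simp add: add_divide_distrib)
    }
  next
    fix y :: "int ^ 'd" assume "y \<in> torus L \<and> y $ i = 0"
    then have y: "y \<in> torus L" "y $ i = 0" by auto
    obtain h where h: "L = 2 * h" using assms(3) by (elim evenE)
    define g where "g n = ?G (y + ?e n) + ?G (?e n)" for n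
    \<comment> \<open>modulo \<open>L\<close>, the height \<open>L - n\<close> is \<open>- n\<close>, the flip of \<open>n\<close>\<close>
    have sym: "g (int L - n) = g n" for n
    proof -
      have wrap: "?G u = ?G v" if "wrap L u = wrap L v" for u v
        using that by (simp add: pair_mass_def)
      have "?G (y + ?e (int L - n)) = ?G (flip i (y + ?e n))"
        using y(2) by (intro wrap) (auto simp: wrap_def vec_eq_iff flip_nth axis_def)
      moreover have "?G (?e (int L - n)) = ?G (flip i (?e n))"
        by (intro wrap) (auto simp: wrap_def vec_eq_iff flip_nth axis_def)
      ultimately show ?thesis by (simp only: g_def pair_mass_flip[OF assms(2)])
    qed
    have decr: "g (2 * int k + 1) \<le> g (2 * int j + 1)" if "j \<le> k" "2 * k < h" for j k
    proof (rule convex_symmetric_antimono[of h "\<lambda>k. g (2 * int k + 1)"])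
      show "2 * g (2 * int (k + 1) + 1) \<le> g (2 * int k + 1) + g (2 * int (k + 2) + 1)" if "k + 2 < h" for k
        using midpoint(2)[OF y, of "int k" "int (k + 2)"] that h by (simp add: g_def algebra_simps)
      show "g (2 * int (h - 1 - k) + 1) = g (2 * int k + 1)" if "k < h" for k
        using sym[of "2 * int k + 1"] that h by (simp add: of_nat_diff algebra_simps)
    qed (use that in auto)
    show "antimono_on {n. odd n \<and> 0 < n \<and> real_of_int n < real L / 2}
       (\<lambda>n. torus_two_point L N \<beta> U 0 (y + ?e n) + torus_two_point L N \<beta> U 0 (?e n))"
    proof (rule monotone_onI)
      fix n m :: int
      assume n: "n \<in> {n. odd n \<and> 0 < n \<and> real_of_int n < real L / 2}"
        and m: "m \<in> {n. odd n \<and> 0 < n \<and> real_of_int n < real L / 2}" and "n \<le> m"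
      have less: "n < int h" "m < int h" using n m h by auto
      obtain j where j: "n = 2 * int j + 1" using n by (auto elim!: oddE) (metis nonneg_int_cases)
      obtain k where k: "m = 2 * int k + 1" using m by (auto elim!: oddE) (metis nonneg_int_cases)
      have "g m \<le> g n" using decr[of j k] \<open>n \<le> m\<close> less unfolding j k by simp
      then have "g m / Z0 \<le> g n / Z0" using Z0 by (rule divide_right_mono)
      then show "torus_two_point L N \<beta> U 0 (y + ?e n) + torus_two_point L N \<beta> U 0 (?e n)
          \<ge> torus_two_point L N \<beta> U 0 (y + ?e m) + torus_two_point L N \<beta> U 0 (?e m)"
        using G[OF y, of n] G[OF y, of m] G'[of n] G'[of m] n m less h
        by (simp add: g_def add_divide_distrib)
    qed
  qed
qed

end
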